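(* Let $d=2^n$. Suppose an unknown $n$-qubit channel $\mathcal{C}$ is, with equal probability, either the completely depolarizing channel $\mathcal{D}(\rho)=\mathrm{Tr}(\rho)\,I/d$, or the channel $\rho\mapsto O\rho O^t$ for a single fixed orthogonal matrix $O$ drawn from the Haar measure on $O(d)$. Any learning algorithm without quantum memory (for channels) that decides which case holds with success probability at least $2/3$ must use $T\ge\Omega(d^{2/7})$ applications of $\mathcal{C}$.
   Context: $O(d)=\{O\in U(d): O^t=O^{-1}\}$ is the real orthogonal group with its Haar probability measure. A learning algorithm without quantum memory for an unknown $n$-qubit channel $\mathcal{C}$, using $T$ applications, proceeds in $T$ rounds, with an auxiliary register of an arbitrary number $n'\ge0$ of qubits: in each round it chooses (depending arbitrarily on all previously observed classical outcomes) a pure state $|\phi\rangle$ on $n+n'$ qubits and a POVM $\{F_s\}_s$ on $n+n'$ qubits, applies $\mathcal{C}$ to the first $n$ qubits (i.e. forms $(\mathcal{C}\otimes\mathrm{id})(|\phi\rangle\langle\phi|)$), and observes outcome $s$ with probability $\mathrm{Tr}\big(F_s(\mathcal{C}\otimes\mathrm{id})(|\phi\rangle\langle\phi|)\big)$; no quantum state is retained between rounds. Its final output is an arbitrary function of the classical outcomes. *)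

theory Defs
  imports "HOL-Probability.Probability"
begin

text \<open>Matrices are represented by their entry functions (indices below the dimension);
  vectors by functions nat to complex. A system index i of an (n+n')-qubit register of
  dimension d*d' (d = 2^n, d' = 2^n') is split as i = a*d' + b, where a = i div d' < d
  indexes the first n qubits (on which the channel acts) and b = i mod d' < d' the
  auxiliary register.\<close>

type_synonym cmatf = "nat \<Rightarrow> nat \<Rightarrow> complex"

definition orthogonal_real :: "nat \<Rightarrow> (nat \<Rightarrow> nat \<Rightarrow> real) \<Rightarrow> bool" where
  "orthogonal_real d M \<longleftrightarrow>
     (\<forall>i<d. \<forall>j<d. (\<Sum>k<d. M k i * M k j) = (if i = j then 1 else 0))"

definition real_mats :: "nat \<Rightarrow> (nat \<Rightarrow> nat \<Rightarrow> real) measure" where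
  "real_mats d = PiM {..<d} (\<lambda>_. PiM {..<d} (\<lambda>_. borel))"

definition mat_mult_real :: "nat \<Rightarrow> (nat \<Rightarrow> nat \<Rightarrow> real) \<Rightarrow> (nat \<Rightarrow> nat \<Rightarrow> real) \<Rightarrow> (nat \<Rightarrow> nat \<Rightarrow> real)" where
  "mat_mult_real d Q M = (\<lambda>i\<in>{..<d}. \<lambda>j\<in>{..<d}. \<Sum>k<d. Q i k * M k j)"

text \<open>Haar probability measure on O(d): a probability measure concentrated on O(d)
  and invariant under left multiplication by every orthogonal matrix (this determines it uniquely).\<close>
definition haar_orthogonal :: "nat \<Rightarrow> (nat \<Rightarrow> nat \<Rightarrow> real) measure \<Rightarrow> bool" where
  "haar_orthogonal d \<mu> \<longleftrightarrow>
     sets \<mu> = sets (real_mats d) \<and> prob_space \<mu> \<and>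
     (AE M in \<mu>. orthogonal_real d M) \<and>
     (\<forall>Q. orthogonal_real d Q \<longrightarrow> distr \<mu> (real_mats d) (mat_mult_real d Q) = \<mu>)"

definition pure_state :: "nat \<Rightarrow> (nat \<Rightarrow> complex) \<Rightarrow> bool" where
  "pure_state D \<phi> \<longleftrightarrow> (\<Sum>i<D. (cmod (\<phi> i))\<^sup>2) = 1"

definition psd :: "nat \<Rightarrow> cmatf \<Rightarrow> bool" where
  "psd D A \<longleftrightarrow> (\<forall>v :: nat \<Rightarrow> complex.
      Im (\<Sum>i<D. \<Sum>j<D. cnj (v i) * A i j * v j) = 0 \<and>
      0 \<le> Re (\<Sum>i<D. \<Sum>j<D. cnj (v i) * A i j * v j))"

definition povm :: "nat \<Rightarrow> nat \<Rightarrow> (nat \<Rightarrow> cmatf) \<Rightarrow> bool" where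
  "povm D m F \<longleftrightarrow> (\<forall>s<m. psd D (F s)) \<and>
     (\<forall>i<D. \<forall>j<D. (\<Sum>s<m. F s i j) = (if i = j then 1 else 0))"

text \<open>(O \<otimes> id)(|phi><phi|)(O \<otimes> id)^t for real O acting on the first register.\<close>
definition orth_out :: "nat \<Rightarrow> nat \<Rightarrow> (nat \<Rightarrow> nat \<Rightarrow> real) \<Rightarrow> (nat \<Rightarrow> complex) \<Rightarrow> cmatf" where
  "orth_out d d' M \<phi> = (let \<psi> = (\<lambda>i. \<Sum>a<d. complex_of_real (M (i div d') a) * \<phi> (a * d' + i mod d'))
     in (\<lambda>i j. \<psi> i * cnj (\<psi> j)))"

text \<open>(D \<otimes> id)(|phi><phi|) = I/d \<otimes> Tr_1(|phi><phi|) for the completely depolarizing channel D.\<close>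
definition dep_out :: "nat \<Rightarrow> nat \<Rightarrow> (nat \<Rightarrow> complex) \<Rightarrow> cmatf" where
  "dep_out d d' \<phi> = (\<lambda>i j. if i div d' = j div d'
      then (1 / of_nat d) * (\<Sum>c<d. \<phi> (c * d' + i mod d') * cnj (\<phi> (c * d' + j mod d')))
      else 0)"

definition outcome_prob :: "nat \<Rightarrow> cmatf \<Rightarrow> cmatf \<Rightarrow> real" where
  "outcome_prob D F \<sigma> = Re (\<Sum>i<D. \<Sum>j<D. F i j * \<sigma> j i)"

text \<open>A strategy maps the history of observed outcomes to the next input state
  phi, the number m of outcomes and the POVM F (outcomes {..<m}).\<close>
type_synonym strategy = "nat list \<Rightarrow> (nat \<Rightarrow> complex) \<times> nat \<times> (nat \<Rightarrow> cmatf)"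

definition valid_strategy :: "nat \<Rightarrow> strategy \<Rightarrow> bool" where
  "valid_strategy D strat \<longleftrightarrow>
     (\<forall>h. case strat h of (\<phi>, m, F) \<Rightarrow> pure_state D \<phi> \<and> povm D m F)"

fun accept_prob :: "nat \<Rightarrow> ((nat \<Rightarrow> complex) \<Rightarrow> cmatf) \<Rightarrow> strategy \<Rightarrow> (nat list \<Rightarrow> bool)
                     \<Rightarrow> nat \<Rightarrow> nat list \<Rightarrow> real" where
  "accept_prob D chan strat out 0 h = (if out h then 1 else 0)"
| "accept_prob D chan strat out (Suc T) h =
     (case strat h of (\<phi>, m, F) \<Rightarrow>
        \<Sum>s<m. outcome_prob D (F s) (chan \<phi>) * accept_prob D chan strat out T (h @ [s]))"

text \<open>Success probability of distinguishing (prior 1/2 each): output True means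
  "the channel is rho \<mapsto> O rho O^t", output False means "completely depolarizing".\<close>
definition success_prob :: "nat \<Rightarrow> nat \<Rightarrow> (nat \<Rightarrow> nat \<Rightarrow> real) measure \<Rightarrow> strategy
                             \<Rightarrow> (nat list \<Rightarrow> bool) \<Rightarrow> nat \<Rightarrow> real" where
  "success_prob d d' \<mu> strat out T =
     1/2 * (1 - accept_prob (d * d') (dep_out d d') strat out T []) +
     1/2 * (\<integral>M. accept_prob (d * d') (orth_out d d' M) strat out T [] \<partial>\<mu>)"

end

(*
Conditioned on a transcript, every POVM element contributes a positive semidefinite quadratic form in
the entries of O, that is, a sum of squares <O,B>^2 of real linear forms, and the depolarizing channel
gives the corresponding weight the sum of the |B|^2 / d. Hence it suffices to show
  E prod_t <O,A_t>^2 >= (1 - T eps) prod_t |A_t|^2 / d,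
for then every transcript is almost as likely under a random O as under the depolarizing channel.

Let V t be the space of polynomial functions of degree t on O(d) that are orthogonal in L^2 to those
of lower degree. For a unit matrix A, x = <O,A> and h in V t, split x h = u + v with u in V (t+1) and v
of lower degree. The component of prod_t <O,A_t> of top degree is obtained by iterating h |-> u, and its
norm is a lower bound, so one needs |u|^2 >= (1 - eps) |h|^2 / d. In the Gaussian case u is a creation
operator and this is immediate. On O(d) it follows from the Casimir (Laplace) operator L, which is
t (d - 1) + N_t on V t with |N_t| <= t (t - 1) (N_t is a sum of transpositions of tensor legs), and from
the commutator identity
  <x h, L (x h)> = <x L h, x h> + E h^2 |grad x|^2,
giving (d - 1) (|u|^2 - |v|^2) = E h^2 |grad x|^2 + <x h, x N_t h> - <u, N u> - <v, N v>. Here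
|grad x|^2 = 1 - tr((O A^t)^2) is close to 1 on average, and the remaining terms cost a relative error
of order t^(5/2) / d, whence T^(7/2) / d in total.
*)

theory Submission
  imports Defs
begin

section \<open>Differentiation along rotations of two rows\<close>

text \<open>The exponent 5/2 is 2 + 1/2: \<open>Nop\<close> has norm at most t (t - 1) on
  \<open>V t\<close>, and multiplication by x has norm of order sqrt (t / d) there. Estimating both
  factors of <x h, x N_t h> would cost t^3 / d and end at d^(1/4). Instead only |x N_t h| is
  estimated; |x h|^2 = |u|^2 + |v|^2 is kept, and by a weighted AM-GM inequality it merely changes
  the coefficients of |u|^2 and -|v|^2 by order t^(5/2), small against d. The |v|^2 term keeps its
  sign and is dropped.

  The obstacle is the norm of x: pointwise only |x| <= sqrt d is known. The same identity, read as
  an upper bound for u, improves any poor bound, and v is controlled by adjointness through u one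
  degree below. This bootstrap needs t^3 small against d.

  Replacing |grad x|^2 by 1 costs sqrt (t / d) per query, T^(3/2) / d^(1/2) in total, of lower order
  when T is about d^(2/7). It rests on tr((O A^t)^2) being almost an eigenfunction of L, for an
  eigenvalue near 2 d, with a gradient bounded independently of d.\<close>

type_synonym rmat = "nat \<Rightarrow> nat \<Rightarrow> real"

definition rot :: "nat \<times> nat \<Rightarrow> real \<Rightarrow> rmat \<Rightarrow> rmat" where
  "rot p \<theta> M = (\<lambda>i j. if i = fst p then cos \<theta> * M (fst p) j - sin \<theta> * M (snd p) j
                else if i = snd p then sin \<theta> * M (fst p) j + cos \<theta> * M (snd p) j else M i j)"

definition Dv :: "nat \<times> nat \<Rightarrow> (rmat \<Rightarrow> real) \<Rightarrow> rmat \<Rightarrow> real" where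
  "Dv p f M = deriv (\<lambda>\<theta>. f (rot p \<theta> M)) 0"

lemma rot_0 [simp]: "rot p 0 M = M"
  by (auto simp: rot_def fun_eq_iff)

text \<open>Polynomials as functions on all matrices. The class is closed under \<open>Dv\<close>
  and its members are bounded on O(d), so differentiability and integrability never need separate
  hypotheses.\<close>

inductive pol :: "nat \<Rightarrow> (rmat \<Rightarrow> real) \<Rightarrow> bool" for d where
  pol_const [intro, simp]: "pol d (\<lambda>_. c)"
| pol_coord [intro, simp]: "i < d \<Longrightarrow> j < d \<Longrightarrow> pol d (\<lambda>M. M i j)"
| pol_add [intro, simp]: "pol d f \<Longrightarrow> pol d g \<Longrightarrow> pol d (\<lambda>M. f M + g M)"
| pol_mult [intro, simp]: "pol d f \<Longrightarrow> pol d g \<Longrightarrow> pol d (\<lambda>M. f M * g M)"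

lemma pol_minus [intro, simp]: "pol d f \<Longrightarrow> pol d (\<lambda>M. - f M)"
  using pol_mult[OF pol_const[of d "-1"], of f] by simp

lemma pol_diff [intro, simp]: "pol d f \<Longrightarrow> pol d g \<Longrightarrow> pol d (\<lambda>M. f M - g M)"
  using pol_add[of d f "\<lambda>M. - g M"] by simp

lemma pol_sum [intro]: "(\<And>i. i \<in> I \<Longrightarrow> pol d (f i)) \<Longrightarrow> pol d (\<lambda>M. \<Sum>i\<in>I. f i M)"
  by (induction I rule: infinite_finite_induct) auto

lemma pol_sum_simp [simp]: "(\<And>i. i \<in> I =simp=> pol d (f i)) \<Longrightarrow> pol d (\<lambda>M. \<Sum>i\<in>I. f i M)"
  unfolding simp_implies_def by (rule pol_sum)

lemma pol_power [intro, simp]: "pol d f \<Longrightarrow> pol d (\<lambda>M. f M ^ n)"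
  by (induction n) auto

lemma pol_divide [intro, simp]: "pol d f \<Longrightarrow> pol d (\<lambda>M. f M / c)"
  using pol_mult[OF _ pol_const[of d "1/c"], of f] by simp

text \<open>The pairs a < b index the standard basis of the Lie algebra so(d).\<close>

definition planes :: "nat \<Rightarrow> (nat \<times> nat) set" where
  "planes d = {p. fst p < snd p \<and> snd p < d}"

lemma finite_planes [simp, intro]: "finite (planes d)"
  by (rule finite_subset[of _ "{..<d} \<times> {..<d}"]) (auto simp: planes_def)

text \<open>The derivative is demanded at every angle, not only at 0. This builds in the
  one-parameter group law, which the mean value argument in \<open>E_Dv\<close> relies on.\<close>

definition is_Dv :: "nat \<times> nat \<Rightarrow> (rmat \<Rightarrow> real) \<Rightarrow> (rmat \<Rightarrow> real) \<Rightarrow> bool" where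
  "is_Dv p f g \<longleftrightarrow>
     (\<forall>M \<theta>. ((\<lambda>\<theta>. f (rot p \<theta> M)) has_real_derivative g (rot p \<theta> M)) (at \<theta>))"

lemma is_Dv_eq: "is_Dv p f g \<Longrightarrow> Dv p f = g"
proof
  fix M assume "is_Dv p f g"
  then have "((\<lambda>\<theta>. f (rot p \<theta> M)) has_real_derivative g (rot p 0 M)) (at 0)"
    unfolding is_Dv_def by blast
  then show "Dv p f M = g M" by (simp add: Dv_def DERIV_imp_deriv)
qed

lemma is_Dv_const: "is_Dv p (\<lambda>_. c) (\<lambda>_. 0)"
  by (simp add: is_Dv_def)

lemma is_Dv_add: "is_Dv p f f' \<Longrightarrow> is_Dv p g g' \<Longrightarrow> is_Dv p (\<lambda>M. f M + g M) (\<lambda>M. f' M + g' M)"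
  unfolding is_Dv_def by (auto intro!: DERIV_add)

lemma is_Dv_mult: "is_Dv p f f' \<Longrightarrow> is_Dv p g g' \<Longrightarrow>
    is_Dv p (\<lambda>M. f M * g M) (\<lambda>M. f' M * g M + g' M * f M)"
  unfolding is_Dv_def by (auto intro!: DERIV_mult)

lemma is_Dv_coord:
  assumes "fst p \<noteq> snd p"
  shows "is_Dv p (\<lambda>M. M i j) (\<lambda>M. if i = fst p then - M (snd p) j else if i = snd p then M (fst p) j else 0)"
  unfolding is_Dv_def using assms
  by (auto simp: rot_def intro!: derivative_eq_intros)

lemma pol_is_Dv:
  assumes "pol d f" "p \<in> planes d"
  shows "\<exists>g. pol d g \<and> is_Dv p f g"
  using assms(1)
proof induction
  case (pol_const c)
  then show ?case using is_Dv_const by blast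
next
  case (pol_coord i j)
  have "pol d (\<lambda>M. if i = fst p then - M (snd p) j else if i = snd p then M (fst p) j else 0)"
    using assms(2) pol_coord by (cases "i = fst p"; cases "i = snd p") (auto simp: planes_def)
  moreover have "fst p \<noteq> snd p" using assms(2) by (auto simp: planes_def)
  ultimately show ?case using is_Dv_coord by blast
next
  case (pol_add f g)
  then show ?case using is_Dv_add by (metis (no_types, lifting) pol.pol_add)
next
  case (pol_mult f g)
  then obtain f' g' where "pol d f'" "is_Dv p f f'" "pol d g'" "is_Dv p g g'" by blast
  then show ?case using pol_mult.hyps is_Dv_mult[of p f f' g g']
    by (intro exI[of _ "\<lambda>M. f' M * g M + g' M * f M"]) auto
qed

lemma pol_Dv [intro, simp]: "pol d f \<Longrightarrow> p \<in> planes d \<Longrightarrow> pol d (Dv p f)"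
  using pol_is_Dv is_Dv_eq by blast

lemma is_Dv_Dv: "pol d f \<Longrightarrow> p \<in> planes d \<Longrightarrow> is_Dv p f (Dv p f)"
  using pol_is_Dv is_Dv_eq by blast

lemma Dv_const [simp]: "Dv p (\<lambda>_. c) = (\<lambda>_. 0)"
  by (rule is_Dv_eq[OF is_Dv_const])

lemma Dv_coord: "p \<in> planes d \<Longrightarrow> Dv p (\<lambda>M. M i j) =
    (\<lambda>M. if i = fst p then - M (snd p) j else if i = snd p then M (fst p) j else 0)"
  by (rule is_Dv_eq[OF is_Dv_coord]) (auto simp: planes_def)

lemma Dv_add: "p \<in> planes d \<Longrightarrow> pol d f \<Longrightarrow> pol d g \<Longrightarrow>
    Dv p (\<lambda>M. f M + g M) = (\<lambda>M. Dv p f M + Dv p g M)"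
  by (rule is_Dv_eq[OF is_Dv_add]) (auto intro: is_Dv_Dv)

lemma Dv_mult: "p \<in> planes d \<Longrightarrow> pol d f \<Longrightarrow> pol d g \<Longrightarrow>
    Dv p (\<lambda>M. f M * g M) = (\<lambda>M. Dv p f M * g M + Dv p g M * f M)"
  by (rule is_Dv_eq[OF is_Dv_mult]) (auto intro: is_Dv_Dv)

lemma Dv_cmult: "p \<in> planes d \<Longrightarrow> pol d f \<Longrightarrow> Dv p (\<lambda>M. c * f M) = (\<lambda>M. c * Dv p f M)"
  using Dv_mult[of p d "\<lambda>_. c" f] by (simp add: mult.commute)

lemma Dv_sum:
  assumes "p \<in> planes d" "\<And>i. i \<in> I =simp=> pol d (f i)"
  shows "Dv p (\<lambda>M. \<Sum>i\<in>I. f i M) = (\<lambda>M. \<Sum>i\<in>I. Dv p (f i) M)"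
  using assms(2) unfolding simp_implies_def
proof (induction I rule: infinite_finite_induct)
  case (insert i I)
  then show ?case using assms(1) by (simp add: Dv_add[OF assms(1)])
qed auto

abbreviation rows_rot :: "nat \<times> nat \<Rightarrow> real \<Rightarrow> rmat" where
  "rows_rot p \<theta> \<equiv> rot p \<theta> (\<lambda>i j. if i = j then 1 else 0)"

lemma sum_two:
  fixes f :: "nat \<Rightarrow> real"
  assumes "a < d" "b < d" "a \<noteq> b"
  shows "(\<Sum>k<d. f k) = f a + f b + (\<Sum>k\<in>{..<d} - {a, b}. f k)"
proof -
  have "(\<Sum>k<d. f k) = (\<Sum>k\<in>{a,b}. f k) + (\<Sum>k\<in>{..<d} - {a, b}. f k)"
    using assms by (subst sum.subset_diff[of "{a,b}"]) auto
  with assms show ?thesis by simp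
qed

lemma rot_trig:
  "(cos t * x - sin t * y) * (cos t * x' - sin t * y') + (sin t * x + cos t * y) * (sin t * x' + cos t * y')
   = x * x' + y * (y' :: real)"
proof -
  have "(cos t * x - sin t * y) * (cos t * x' - sin t * y') + (sin t * x + cos t * y) * (sin t * x' + cos t * y')
    = ((sin t)\<^sup>2 + (cos t)\<^sup>2) * (x * x' + y * y')"
    by (simp only: power2_eq_square) algebra
  then show ?thesis by simp
qed

lemma orthogonal_rot:
  assumes "p \<in> planes d" "orthogonal_real d M"
  shows "orthogonal_real d (rot p \<theta> M)"
proof -
  obtain a b where p: "p = (a, b)" by force
  have ab: "a < d" "b < d" "a \<noteq> b" using assms p by (auto simp: planes_def)
  have "(\<Sum>k<d. rot p \<theta> M k i * rot p \<theta> M k j) = (\<Sum>k<d. M k i * M k j)" for i j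
    using ab by (simp add: sum_two[OF ab] rot_def p rot_trig)
  with assms(2) show ?thesis by (simp add: orthogonal_real_def)
qed

text \<open>Agreement can hold only on the d x d block, since \<open>mat_mult_real\<close> is
  undefined outside it. For polynomials this is enough by \<open>pol_cong_entries\<close>.\<close>

lemma mat_mult_rot:
  assumes "p \<in> planes d" "i < d" "j < d"
  shows "mat_mult_real d (rows_rot p \<theta>) M i j = rot p \<theta> M i j"
proof -
  obtain a b where p: "p = (a, b)" by force
  have ab: "a < d" "b < d" "a \<noteq> b" using assms p by (auto simp: planes_def)
  have "(\<Sum>k<d. rows_rot p \<theta> i k * M k j) = rot p \<theta> M i j"
  proof (cases "i = a \<or> i = b")
    case True
    have "(\<Sum>k\<in>{..<d} - {a, b}. rows_rot p \<theta> i k * M k j) = 0"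
      using True by (intro sum.neutral) (auto simp: rot_def p)
    then show ?thesis using ab True by (subst sum_two[OF ab]) (auto simp: rot_def p)
  next
    case False
    then have "(\<Sum>k<d. rows_rot p \<theta> i k * M k j) = (\<Sum>k<d. if k = i then M k j else 0)"
      by (intro sum.cong) (auto simp: rot_def p)
    then show ?thesis using False assms by (simp add: rot_def p)
  qed
  then show ?thesis using assms by (simp add: mat_mult_real_def)
qed

lemma pol_cong_entries:
  assumes "pol d f" "\<And>i j. i < d \<Longrightarrow> j < d \<Longrightarrow> M i j = M' i j"
  shows "f M = f M'"
  using assms(1) by induction (auto simp: assms(2))

lemma orthogonal_real_entry_le_1:
  assumes "orthogonal_real d M" "i < d" "j < d"
  shows "\<bar>M i j\<bar> \<le> 1"
proof -
  have "(M i j)\<^sup>2 \<le> (\<Sum>k<d. (M k j)\<^sup>2)"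
    using assms by (intro member_le_sum) auto
  also have "\<dots> = 1" using assms by (simp add: orthogonal_real_def power2_eq_square)
  finally show ?thesis by (simp add: abs_square_le_1)
qed

lemma pol_bounded:
  assumes "pol d f"
  shows "\<exists>B. \<forall>M. orthogonal_real d M \<longrightarrow> \<bar>f M\<bar> \<le> B"
  using assms
proof induction
  case (pol_coord i j)
  then show ?case using orthogonal_real_entry_le_1 by blast
next
  case (pol_add f g)
  then obtain B C where BC: "\<And>M. orthogonal_real d M \<Longrightarrow> \<bar>f M\<bar> \<le> B" "\<And>M. orthogonal_real d M \<Longrightarrow> \<bar>g M\<bar> \<le> C"
    by blast
  show ?case
    by (intro exI[of _ "B + C"]) (auto intro!: order_trans[OF abs_triangle_ineq] add_mono BC)
next
  case (pol_mult f g)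
  then obtain B C where BC: "\<And>M. orthogonal_real d M \<Longrightarrow> \<bar>f M\<bar> \<le> B" "\<And>M. orthogonal_real d M \<Longrightarrow> \<bar>g M\<bar> \<le> C"
    by blast
  have "0 \<le> B" if "orthogonal_real d M" for M using BC(1)[OF that] by linarith
  then show ?case
    by (intro exI[of _ "B * C"]) (auto simp: abs_mult intro!: mult_mono BC)
qed auto

section \<open>Haar expectation of polynomials and integration by parts\<close>

locale orth_haar =
  fixes d :: nat and \<mu> :: "rmat measure"
  assumes haar: "haar_orthogonal d \<mu>"
begin

sublocale prob_space \<mu>
  using haar by (simp add: haar_orthogonal_def)

abbreviation E :: "(rmat \<Rightarrow> real) \<Rightarrow> real" where
  "E f \<equiv> integral\<^sup>L \<mu> f"

lemma sets_mu: "sets \<mu> = sets (real_mats d)"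
  and AE_orth: "AE M in \<mu>. orthogonal_real d M"
  and invariant: "orthogonal_real d Q \<Longrightarrow> distr \<mu> (real_mats d) (mat_mult_real d Q) = \<mu>"
  using haar by (auto simp: haar_orthogonal_def)

lemma measurable_entry: "i < d \<Longrightarrow> j < d \<Longrightarrow> (\<lambda>M. M i j) \<in> borel_measurable (real_mats d)"
  unfolding real_mats_def
  by (rule measurable_compose[of "\<lambda>M. M i" _ "PiM {..<d} (\<lambda>_. borel)" "\<lambda>r. r j"])
    (auto intro: measurable_component_singleton)

lemma pol_measurable_real_mats: "pol d f \<Longrightarrow> f \<in> borel_measurable (real_mats d)"
  by (induction rule: pol.induct) (auto intro: measurable_entry)

lemma pol_measurable: "pol d f \<Longrightarrow> f \<in> borel_measurable \<mu>"
  using pol_measurable_real_mats measurable_cong_sets[OF sets_mu refl] by blast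

lemma integrable_pol [intro, simp]:
  assumes "pol d f"
  shows "integrable \<mu> f"
proof -
  obtain B where B: "\<And>M. orthogonal_real d M \<Longrightarrow> \<bar>f M\<bar> \<le> B" using pol_bounded[OF assms] by blast
  show ?thesis
    by (rule integrable_const_bound[of _ B]) (use AE_orth B pol_measurable[OF assms] in auto)
qed

lemma mat_mult_measurable:
  "mat_mult_real d Q \<in> measurable (real_mats d) (real_mats d)"
proof -
  have "(\<lambda>M. \<Sum>k<d. Q i k * M k j) \<in> borel_measurable (real_mats d)" if "i < d" "j < d" for i j
    using that by (intro borel_measurable_sum borel_measurable_times borel_measurable_const measurable_entry) auto
  then show ?thesis
    unfolding mat_mult_real_def real_mats_def[of d, THEN arg_cong, of "measurable (real_mats d)"]
    by (intro measurable_restrict) auto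
qed

lemma E_rot:
  assumes "pol d f" "p \<in> planes d"
  shows "E (\<lambda>M. f (rot p \<theta> M)) = E f"
proof -
  have "orthogonal_real d (\<lambda>i j. if i = j then 1 else 0)"
    by (auto simp: orthogonal_real_def if_distrib[of "\<lambda>x. x * _"] cong: if_cong)
  then have Q: "orthogonal_real d (rows_rot p \<theta>)" using orthogonal_rot assms(2) by blast
  have "E f = integral\<^sup>L (distr \<mu> (real_mats d) (mat_mult_real d (rows_rot p \<theta>))) f"
    by (simp add: invariant[OF Q])
  also have "\<dots> = E (\<lambda>M. f (mat_mult_real d (rows_rot p \<theta>) M))"
    by (rule integral_distr)
      (use mat_mult_measurable measurable_cong_sets[OF sets_mu refl] pol_measurable_real_mats assms in blast)+
  also have "\<dots> = E (\<lambda>M. f (rot p \<theta> M))"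
    by (intro Bochner_Integration.integral_cong refl pol_cong_entries[OF assms(1)] mat_mult_rot assms(2))
  finally show ?thesis by simp
qed

lemma E_cong: "pol d f \<Longrightarrow> pol d g \<Longrightarrow> (\<And>M. orthogonal_real d M \<Longrightarrow> f M = g M) \<Longrightarrow> E f = E g"
  using AE_orth by (intro integral_cong_AE pol_measurable) auto

lemma E_mono: "pol d f \<Longrightarrow> pol d g \<Longrightarrow> (\<And>M. orthogonal_real d M \<Longrightarrow> f M \<le> g M) \<Longrightarrow> E f \<le> E g"
  using AE_orth by (intro integral_mono_AE integrable_pol) auto

text \<open>The source of all integration by parts. By rotation invariance every difference quotient
  has expectation 0; the quotients tend to \<open>Dv p f\<close> and, by the mean value theorem,
  share its bound on O(d), so dominated convergence applies.\<close>

lemma E_Dv: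
  assumes f: "pol d f" and p: "p \<in> planes d"
  shows "E (Dv p f) = 0"
proof -
  let ?g = "Dv p f"
  obtain B where B: "\<And>M. orthogonal_real d M \<Longrightarrow> \<bar>?g M\<bar> \<le> B"
    using pol_bounded[of d ?g] f p by auto
  have D: "((\<lambda>\<theta>. f (rot p \<theta> M)) has_real_derivative ?g (rot p \<theta> M)) (at \<theta>)" for M \<theta>
    using is_Dv_Dv[OF f p] by (simp add: is_Dv_def)
  define q where "q = (\<lambda>n M. (f (rot p (1 / real (Suc n)) M) - f M) * real (Suc n))"
  have polrot: "pol d (\<lambda>M. f (rot p \<theta> M))" for \<theta>
    using f
  proof induction
    case (pol_coord i j)
    then show ?case using p
      by (cases "i = fst p"; cases "i = snd p") (auto simp: planes_def rot_def)
  qed auto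
  have q_pol: "pol d (q n)" for n using polrot f by (auto simp: q_def)
  have q0: "E (q n) = 0" for n
    using E_rot[OF f p] polrot f by (simp add: q_def Bochner_Integration.integral_diff)
  have lim: "(\<lambda>n. q n M) \<longlonglongrightarrow> ?g M" for M
  proof -
    have "((\<lambda>h. (f (rot p h M) - f M) / h) \<longlongrightarrow> ?g M) (at 0)"
      using D[of M 0] by (simp add: DERIV_def)
    moreover have "filterlim (\<lambda>n. 1 / real (Suc n)) (at 0) sequentially"
      unfolding filterlim_at using LIMSEQ_Suc[OF lim_1_over_n] by auto
    ultimately have "(\<lambda>n. (f (rot p (1 / real (Suc n)) M) - f M) / (1 / real (Suc n))) \<longlonglongrightarrow> ?g M"
      by (rule filterlim_compose)
    then show ?thesis by (simp add: q_def)
  qed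
  have bound: "\<bar>q n M\<bar> \<le> B" if M: "orthogonal_real d M" for n M
  proof -
    have "\<exists>z::real. 0 < z \<and> z < 1 / real (Suc n) \<and>
      f (rot p (1 / real (Suc n)) M) - f (rot p 0 M) = (1 / real (Suc n) - 0) * ?g (rot p z M)"
      by (rule MVT2) (use D in auto)
    then obtain z where "f (rot p (1 / real (Suc n)) M) - f M = (1 / real (Suc n)) * ?g (rot p z M)"
      by auto
    then have "q n M = ?g (rot p z M)" by (simp add: q_def field_simps)
    then show ?thesis using B[OF orthogonal_rot[OF p M]] by simp
  qed
  have "(\<lambda>n. E (q n)) \<longlonglongrightarrow> E ?g"
  proof (rule integral_dominated_convergence[where w = "\<lambda>_. B"])
    show "?g \<in> borel_measurable \<mu>" "\<And>n. q n \<in> borel_measurable \<mu>"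
      using q_pol f p pol_measurable by auto
    show "AE M in \<mu>. (\<lambda>n. q n M) \<longlonglongrightarrow> ?g M" using lim by simp
    show "\<And>n. AE M in \<mu>. norm (q n M) \<le> B" using AE_orth bound by auto
  qed auto
  with q0 show ?thesis by (simp add: LIMSEQ_const_iff)
qed

end

section \<open>The Casimir operator and the degree filtration\<close>

text \<open>The carre du champ <grad f, grad g> for the frame of row rotations.\<close>

definition Gam :: "nat \<Rightarrow> (rmat \<Rightarrow> real) \<Rightarrow> (rmat \<Rightarrow> real) \<Rightarrow> rmat \<Rightarrow> real" where
  "Gam d f g M = (\<Sum>p\<in>planes d. Dv p f M * Dv p g M)"

text \<open>The Casimir operator, with the sign that makes it positive semidefinite.\<close>

definition Lap :: "nat \<Rightarrow> (rmat \<Rightarrow> real) \<Rightarrow> rmat \<Rightarrow> real" where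
  "Lap d f M = - (\<Sum>p\<in>planes d. Dv p (Dv p f) M)"

lemma pol_Gam [intro, simp]: "pol d f \<Longrightarrow> pol d g \<Longrightarrow> pol d (Gam d f g)"
  unfolding Gam_def[abs_def] by auto

lemma pol_Lap [intro, simp]: "pol d f \<Longrightarrow> pol d (Lap d f)"
  unfolding Lap_def[abs_def] by auto

lemma Gam_commute: "Gam d f g = Gam d g f"
  by (auto simp: Gam_def fun_eq_iff mult.commute)

lemma Gam_const [simp]: "Gam d f (\<lambda>_. c) = (\<lambda>_. 0)"
  by (auto simp: Gam_def fun_eq_iff)

lemma Gam_self_nonneg: "0 \<le> Gam d f f M"
  by (auto simp: Gam_def intro: sum_nonneg)

lemma Gam_Cauchy_Schwarz: "(Gam d f g M)\<^sup>2 \<le> Gam d f f M * Gam d g g M"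
  using Cauchy_Schwarz_ineq_sum[of "\<lambda>p. Dv p f M" "\<lambda>p. Dv p g M" "planes d"]
  by (simp add: Gam_def power2_eq_square)

lemma Gam_add: "pol d g \<Longrightarrow> pol d h \<Longrightarrow> Gam d f (\<lambda>M. g M + h M) = (\<lambda>M. Gam d f g M + Gam d f h M)"
  by (auto simp: Gam_def fun_eq_iff Dv_add algebra_simps sum.distrib)

lemma Gam_mult: "pol d g \<Longrightarrow> pol d h \<Longrightarrow>
    Gam d f (\<lambda>M. g M * h M) = (\<lambda>M. g M * Gam d f h M + h M * Gam d f g M)"
  by (auto simp: Gam_def fun_eq_iff Dv_mult algebra_simps sum.distrib sum_distrib_left)

lemma Gam_cmult: "pol d g \<Longrightarrow> Gam d f (\<lambda>M. c * g M) = (\<lambda>M. c * Gam d f g M)"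
  using Gam_mult[of d "\<lambda>_. c" g f] by simp

lemma Gam_sum: "(\<And>i. i \<in> I =simp=> pol d (g i)) \<Longrightarrow>
    Gam d f (\<lambda>M. \<Sum>i\<in>I. g i M) = (\<lambda>M. \<Sum>i\<in>I. Gam d f (g i) M)"
  unfolding simp_implies_def by (induction I rule: infinite_finite_induct) (auto simp: Gam_add)

lemma Lap_const [simp]: "Lap d (\<lambda>_. c) = (\<lambda>_. 0)"
  by (auto simp: Lap_def fun_eq_iff)

lemma Lap_add: "pol d g \<Longrightarrow> pol d h \<Longrightarrow> Lap d (\<lambda>M. g M + h M) = (\<lambda>M. Lap d g M + Lap d h M)"
  by (auto simp: Lap_def fun_eq_iff Dv_add sum.distrib)

lemma Lap_mult:
  assumes "pol d g" "pol d h"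
  shows "Lap d (\<lambda>M. g M * h M) = (\<lambda>M. g M * Lap d h M + h M * Lap d g M - 2 * Gam d g h M)"
proof -
  have "Dv p (Dv p (\<lambda>M. g M * h M)) =
    (\<lambda>M. g M * Dv p (Dv p h) M + h M * Dv p (Dv p g) M + 2 * (Dv p g M * Dv p h M))"
    if p: "p \<in> planes d" for p
    using assms p by (simp add: Dv_mult[OF p] Dv_add[OF p] fun_eq_iff algebra_simps)
  then show ?thesis
    by (simp add: Lap_def Gam_def fun_eq_iff sum.distrib sum_distrib_left sum_negf)
qed

lemma Lap_cmult: "pol d g \<Longrightarrow> Lap d (\<lambda>M. c * g M) = (\<lambda>M. c * Lap d g M)"
  using Lap_mult[of d "\<lambda>_. c" g] by (simp add: Gam_commute[of d "\<lambda>_. c"])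

lemma Lap_sum: "(\<And>i. i \<in> I =simp=> pol d (g i)) \<Longrightarrow>
    Lap d (\<lambda>M. \<Sum>i\<in>I. g i M) = (\<lambda>M. \<Sum>i\<in>I. Lap d (g i) M)"
  unfolding simp_implies_def by (induction I rule: infinite_finite_induct) (auto simp: Lap_add)

text \<open>Rotations preserve O(d), so derivatives at orthogonal matrices depend only on values on
  O(d). This makes \<open>dg_cong\<close> and \<open>hk_cong\<close> compatible with
  \<open>Lap\<close> and \<open>Gam\<close>.\<close>

lemma Dv_cong:
  assumes "\<And>M. orthogonal_real d M \<Longrightarrow> f M = g M" "p \<in> planes d" "orthogonal_real d M"
  shows "Dv p f M = Dv p g M"
proof -
  have "(\<lambda>\<theta>. f (rot p \<theta> M)) = (\<lambda>\<theta>. g (rot p \<theta> M))"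
    using assms orthogonal_rot by blast
  then show ?thesis by (simp add: Dv_def)
qed

lemma Lap_cong:
  assumes "\<And>M. orthogonal_real d M \<Longrightarrow> f M = g M" "orthogonal_real d M"
  shows "Lap d f M = Lap d g M"
  unfolding Lap_def using assms by (auto intro!: sum.cong Dv_cong)

lemma Gam_cong:
  assumes "\<And>M. orthogonal_real d M \<Longrightarrow> f M = f' M" "\<And>M. orthogonal_real d M \<Longrightarrow> g M = g' M"
    "orthogonal_real d M"
  shows "Gam d f g M = Gam d f' g' M"
  unfolding Gam_def
proof (rule sum.cong)
  fix p assume p: "p \<in> planes d"
  show "Dv p f M * Dv p g M = Dv p f' M * Dv p g' M"
    using Dv_cong[OF assms(1) p assms(3)] Dv_cong[OF assms(2) p assms(3)] by simp
qed simp

text \<open>Only planes containing row i contribute, one for each other row b; \<open>min\<close>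
  and \<open>max\<close> put the pair in order.\<close>

lemma sum_planes_through:
  fixes f :: "nat \<Rightarrow> nat \<Rightarrow> real"
  assumes "i < d" "\<And>a b. f a b = f b a" "\<And>a b. a \<noteq> i \<Longrightarrow> b \<noteq> i \<Longrightarrow> f a b = 0"
  shows "(\<Sum>p\<in>planes d. f (fst p) (snd p)) = (\<Sum>b\<in>{..<d} - {i}. f i b)"
proof -
  let ?m = "\<lambda>b. (min i b, max i b)"
  have "(\<Sum>p\<in>planes d. f (fst p) (snd p)) = (\<Sum>p\<in>?m ` ({..<d} - {i}). f (fst p) (snd p))"
  proof (rule sum.mono_neutral_right)
    show "\<forall>p\<in>planes d - ?m ` ({..<d} - {i}). f (fst p) (snd p) = 0"
    proof
      fix p assume p: "p \<in> planes d - ?m ` ({..<d} - {i})"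
      obtain a b where ab: "p = (a, b)" by force
      have "a \<noteq> i" "b \<noteq> i"
        using p by (auto simp: ab planes_def image_iff min_def max_def dest: bspec[of _ _ a] bspec[of _ _ b])
      then show "f (fst p) (snd p) = 0" using assms(3) ab by simp
    qed
    show "?m ` ({..<d} - {i}) \<subseteq> planes d"
      using assms(1) by (auto simp: planes_def min_def max_def)
  qed simp
  also have "\<dots> = (\<Sum>b\<in>{..<d} - {i}. f (min i b) (max i b))"
    by (subst sum.reindex) (auto simp: inj_on_def min_def max_def split: if_splits)
  also have "\<dots> = (\<Sum>b\<in>{..<d} - {i}. f i b)"
    by (intro sum.cong refl) (use assms(2) in \<open>auto simp: min_def max_def\<close>)
  finally show ?thesis .
qed

text \<open>For i = k this is orthonormality of columns; for distinct rows only the plane of i and k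
  contributes. The product \<open>M k j * M i l\<close> is the original monomial with its row
  indices exchanged, a transposition of tensor legs, while the constant term has degree lower by
  two.\<close>

lemma Gam_coord:
  assumes "orthogonal_real d M" "i < d" "j < d" "k < d" "l < d"
  shows "Gam d (\<lambda>M. M i j) (\<lambda>M. M k l) M = (if i = k \<and> j = l then 1 else 0) - M k j * M i l"
proof -
  define e :: "nat \<Rightarrow> nat \<Rightarrow> nat \<Rightarrow> nat \<Rightarrow> real" where
    "e = (\<lambda>i j a b. if a = b then 0 else if i = a then - M b j else if i = b then M a j else 0)"
  have "Gam d (\<lambda>M. M i j) (\<lambda>M. M k l) M =
      (\<Sum>p\<in>planes d. e i j (fst p) (snd p) * e k l (fst p) (snd p))"
    unfolding Gam_def
    by (intro sum.cong refl) (auto simp: Dv_coord e_def, (auto simp: planes_def)[])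
  also have "\<dots> = (\<Sum>b\<in>{..<d} - {i}. e i j i b * e k l i b)"
    by (rule sum_planes_through) (use assms in \<open>auto simp: e_def\<close>)
  also have "\<dots> = (if i = k \<and> j = l then 1 else 0) - M k j * M i l"
  proof (cases "i = k")
    case True
    have "(\<Sum>b\<in>{..<d} - {i}. e i j i b * e k l i b) = (\<Sum>b\<in>{..<d} - {i}. M b j * M b l)"
      by (intro sum.cong) (auto simp: e_def True)
    also have "\<dots> = (\<Sum>b<d. M b j * M b l) - M i j * M i l"
      using assms by (simp add: sum_diff1)
    finally show ?thesis using assms True by (simp add: orthogonal_real_def)
  next
    case False
    have "(\<Sum>b\<in>{..<d} - {i}. e i j i b * e k l i b) = (\<Sum>b\<in>{..<d} - {i}. if b = k then - M k j * M i l else 0)"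
      by (intro sum.cong) (use False in \<open>auto simp: e_def\<close>)
    then show ?thesis using assms False by simp
  qed
  finally show ?thesis .
qed

text \<open>Each of the d - 1 planes through row i sends the coordinate to its negative when applied
  twice.\<close>

lemma Lap_coord:
  assumes "i < d"
  shows "Lap d (\<lambda>M. M i j) = (\<lambda>M. (real d - 1) * M i j)"
proof
  fix M :: rmat
  define e where "e = (\<lambda>a b. if a \<noteq> b \<and> (i = a \<or> i = b) then - M i j else 0)"
  have "Dv p (Dv p (\<lambda>M. M i j)) M = e (fst p) (snd p)" if p: "p \<in> planes d" for p
  proof -
    have ne: "fst p \<noteq> snd p" using p by (auto simp: planes_def)
    have neg: "Dv p (\<lambda>M. - M k j) = (\<lambda>M. - Dv p (\<lambda>M. M k j) M)" if "k < d" for k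
      using is_Dv_eq[OF is_Dv_mult[OF is_Dv_const[of p "-1"] is_Dv_coord[OF ne, of k j]]]
        Dv_coord[OF p, of k j] by simp
    have "fst p < d" "snd p < d" using p by (auto simp: planes_def)
    then show ?thesis using ne
      by (cases "i = fst p"; cases "i = snd p") (simp_all add: Dv_coord[OF p] neg e_def)
  qed
  then have "Lap d (\<lambda>M. M i j) M = - (\<Sum>p\<in>planes d. e (fst p) (snd p))"
    by (simp add: Lap_def)
  also have "\<dots> = - (\<Sum>b\<in>{..<d} - {i}. e i b)"
    using assms by (subst sum_planes_through[of i]) (auto simp: e_def)
  also have "\<dots> = (\<Sum>b\<in>{..<d} - {i}. M i j)"
    unfolding sum_negf[symmetric] by (intro sum.cong) (auto simp: e_def)
  also have "\<dots> = (real d - 1) * M i j"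
    using assms by (simp add: of_nat_diff)
  finally show "Lap d (\<lambda>M. M i j) M = (real d - 1) * M i j" .
qed

text \<open>The index is shifted by two: on \<open>O(d)\<close> the predicate \<open>dg d (t + 2)\<close> describes the polynomials
  of degree at most \<open>t\<close> with the parity of \<open>t\<close>, and \<open>dg d 0\<close>, \<open>dg d 1\<close> contain only zero.\<close>

inductive dg :: "nat \<Rightarrow> nat \<Rightarrow> (rmat \<Rightarrow> real) \<Rightarrow> bool" for d where
  dg_zero: "dg d n (\<lambda>_. 0)"
| dg_const: "dg d 2 (\<lambda>_. c)"
| dg_coord_mult: "dg d n f \<Longrightarrow> i < d \<Longrightarrow> j < d \<Longrightarrow> dg d (Suc n) (\<lambda>M. M i j * f M)"
| dg_add: "dg d n f \<Longrightarrow> dg d n g \<Longrightarrow> dg d n (\<lambda>M. f M + g M)"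
| dg_lower: "dg d n f \<Longrightarrow> dg d (Suc (Suc n)) f"
| dg_cong: "dg d n f \<Longrightarrow> pol d g \<Longrightarrow> (\<And>M. orthogonal_real d M \<Longrightarrow> f M = g M) \<Longrightarrow> dg d n g"

lemma dg_pol: "dg d n f \<Longrightarrow> pol d f"
  by (induction rule: dg.induct) auto

lemma dg_cmult: "dg d n f \<Longrightarrow> dg d n (\<lambda>M. c * f M)"
proof (induction rule: dg.induct)
  case (dg_coord_mult n f i j)
  then have "dg d (Suc n) (\<lambda>M. M i j * (c * f M))" by (intro dg.dg_coord_mult)
  then show ?case by (simp add: mult.left_commute)
next
  case (dg_add n f g)
  then show ?case using dg.dg_add[OF dg_add.IH] by (simp add: distrib_left)
next
  case (dg_cong n f g)
  then show ?case by (intro dg.dg_cong[OF dg_cong.IH]) auto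
qed (auto intro: dg.intros)

lemma dg_minus: "dg d n f \<Longrightarrow> dg d n (\<lambda>M. - f M)"
  using dg_cmult[of d n f "-1"] by simp

lemma dg_diff: "dg d n f \<Longrightarrow> dg d n g \<Longrightarrow> dg d n (\<lambda>M. f M - g M)"
  using dg_add[OF _ dg_minus, of d n f g] by simp

lemma dg_sum: "(\<And>i. i \<in> I \<Longrightarrow> dg d n (f i)) \<Longrightarrow> dg d n (\<lambda>M. \<Sum>i\<in>I. f i M)"
  by (induction I rule: infinite_finite_induct) (auto intro: dg_zero dg_add)

lemma dg_less_2_zero: "dg d n f \<Longrightarrow> n < 2 \<Longrightarrow> orthogonal_real d M \<Longrightarrow> f M = 0"
  by (induction arbitrary: M rule: dg.induct) auto

lemma dg_Dv_coord_mult: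
  assumes "dg d n f" "p \<in> planes d" "i < d" "j < d"
  shows "dg d (Suc n) (\<lambda>M. Dv p (\<lambda>M. M i j) M * f M)"
proof -
  have p: "fst p < d" "snd p < d" "fst p \<noteq> snd p" using assms(2) by (auto simp: planes_def)
  show ?thesis
    using assms p dg_coord_mult[OF assms(1), of "fst p" j] dg_minus[OF dg_coord_mult[OF assms(1), of "snd p" j]]
    by (cases "i = fst p"; cases "i = snd p") (simp_all add: Dv_coord dg_zero)
qed

lemma dg_Dv:
  assumes "dg d n f" "p \<in> planes d"
  shows "dg d n (Dv p f)"
  using assms(1)
proof (induction rule: dg.induct)
  case (dg_coord_mult n f i j)
  have "dg d (Suc n) (\<lambda>M. Dv p (\<lambda>M. M i j) M * f M + M i j * Dv p f M)"
    using dg_coord_mult assms(2) by (intro dg_add dg_Dv_coord_mult dg.dg_coord_mult)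
  then show ?case
    using dg_coord_mult assms(2) by (simp add: Dv_mult dg_pol mult.commute add.commute)
next
  case (dg_add n f g)
  then show ?case using assms(2) dg.dg_add[OF dg_add.IH] by (simp add: Dv_add dg_pol)
next
  case (dg_cong n f g)
  then show ?case using assms(2) by (intro dg.dg_cong[OF dg_cong.IH] pol_Dv Dv_cong) auto
qed (auto intro: dg.intros)

lemma dg_Lap: "dg d n f \<Longrightarrow> dg d n (Lap d f)"
  unfolding Lap_def[abs_def] by (intro dg_minus dg_sum dg_Dv)

lemma dg_Gam_coord:
  assumes "dg d n f" "i < d" "j < d"
  shows "dg d (Suc n) (Gam d (\<lambda>M. M i j) f)"
  unfolding Gam_def[abs_def] using assms by (intro dg_sum dg_Dv_coord_mult dg_Dv)

text \<open>\<open>hk d t K f\<close>: modulo \<open>dg d t\<close>, the function \<open>f\<close> is a combination of monomials of degree \<open>t\<close>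
  whose coefficients have absolute sum at most \<open>K\<close>.\<close>

inductive hk :: "nat \<Rightarrow> nat \<Rightarrow> real \<Rightarrow> (rmat \<Rightarrow> real) \<Rightarrow> bool" for d where
  hk_low: "dg d t f \<Longrightarrow> hk d t 0 f"
| hk_const: "hk d 0 \<bar>c\<bar> (\<lambda>_. c)"
| hk_coord_mult: "hk d t K f \<Longrightarrow> i < d \<Longrightarrow> j < d \<Longrightarrow> hk d (Suc t) K (\<lambda>M. M i j * f M)"
| hk_add: "hk d t K f \<Longrightarrow> hk d t K' g \<Longrightarrow> hk d t (K + K') (\<lambda>M. f M + g M)"
| hk_weaken: "hk d t K f \<Longrightarrow> K \<le> K' \<Longrightarrow> hk d t K' f"
| hk_cong: "hk d t K f \<Longrightarrow> pol d g \<Longrightarrow> (\<And>M. orthogonal_real d M \<Longrightarrow> f M = g M) \<Longrightarrow> hk d t K g"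

lemma hk_nonneg: "hk d t K f \<Longrightarrow> 0 \<le> K"
  by (induction rule: hk.induct) auto

lemma hk_dg: "hk d t K f \<Longrightarrow> dg d (t + 2) f"
  by (induction rule: hk.induct) (auto intro: dg.intros simp: numeral_2_eq_2[symmetric])

lemma hk_pol: "hk d t K f \<Longrightarrow> pol d f"
  using hk_dg dg_pol by blast

text \<open>Some coefficient bound exists, of unknown size. That size disappears in
  \<open>Nop_norm_le\<close>.\<close>

lemma dg_hk:
  assumes "dg d n f" "n = t + 2"
  shows "\<exists>K. hk d t K f"
  using assms
proof (induction arbitrary: t rule: dg.induct)
  case (dg_zero n)
  then show ?case using hk_low dg.dg_zero by blast
next
  case (dg_const c)
  then show ?case using hk_const by auto
next
  case (dg_coord_mult n f i j)
  show ?case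
  proof (cases t)
    \<comment> \<open>Here the factor f lies in \<open>dg d 1\<close>, hence vanishes on
      O(d).\<close>
    case 0
    then have "f M = 0" if "orthogonal_real d M" for M
      using dg_less_2_zero[OF dg_coord_mult.hyps(1)] dg_coord_mult that by simp
    then have "hk d t 0 (\<lambda>M. M i j * f M)"
      using dg_coord_mult by (intro hk_cong[OF hk_low[OF dg_zero]]) (auto intro: dg_pol)
    then show ?thesis ..
  next
    case (Suc s)
    then obtain K where "hk d s K f" using dg_coord_mult by auto
    then show ?thesis using Suc dg_coord_mult hk_coord_mult by blast
  qed
next
  case (dg_add n f g)
  then show ?case using hk_add by blast
next
  case (dg_lower n f)
  then have "t = n" by simp
  then show ?case using hk_low[OF dg_lower.hyps] by blast
next
  case (dg_cong n f g)
  then show ?case using hk_cong by blast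
qed

lemma hk_cmult: "hk d t K f \<Longrightarrow> hk d t (\<bar>c\<bar> * K) (\<lambda>M. c * f M)"
proof (induction rule: hk.induct)
  case (hk_low t f)
  then show ?case using hk.hk_low[OF dg_cmult] by simp
next
  case (hk_const c')
  then show ?case using hk.hk_const[of d "c * c'"] by (simp add: abs_mult)
next
  case (hk_coord_mult t K f i j)
  then show ?case using hk.hk_coord_mult[of d t "\<bar>c\<bar> * K" "\<lambda>M. c * f M" i j]
    by (simp add: mult.left_commute)
next
  case (hk_add t K f K' g)
  then show ?case using hk.hk_add[OF hk_add.IH] by (simp add: distrib_left)
next
  case (hk_weaken t K f K')
  then show ?case by (auto intro!: hk.hk_weaken[OF hk_weaken.IH] mult_left_mono)
next
  case (hk_cong t K f g)
  then show ?case by (intro hk.hk_cong[OF hk_cong.IH]) auto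
qed

text \<open>Entries of an orthogonal matrix are at most 1 in absolute value, so monomials are too: a
  coefficient bound becomes a sup norm bound modulo lower degree.\<close>

lemma hk_split:
  "hk d t K f \<Longrightarrow> \<exists>g. pol d g \<and> (\<forall>M. orthogonal_real d M \<longrightarrow> \<bar>g M\<bar> \<le> K) \<and> dg d t (\<lambda>M. f M - g M)"
proof (induction rule: hk.induct)
  case (hk_low t f)
  then show ?case by (intro exI[of _ "\<lambda>_. 0"]) auto
next
  case (hk_const c)
  then show ?case by (intro exI[of _ "\<lambda>_. c"]) (auto intro: dg_zero)
next
  case (hk_coord_mult t K f i j)
  then obtain g where g: "pol d g" "\<And>M. orthogonal_real d M \<Longrightarrow> \<bar>g M\<bar> \<le> K" "dg d t (\<lambda>M. f M - g M)"
    by blast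
  have "\<bar>M i j\<bar> * \<bar>g M\<bar> \<le> 1 * K" if "orthogonal_real d M" for M
    using that g(2) orthogonal_real_entry_le_1 hk_coord_mult by (intro mult_mono) auto
  moreover have "dg d (Suc t) (\<lambda>M. M i j * f M - M i j * g M)"
    using dg_coord_mult[OF g(3)] hk_coord_mult by (simp add: right_diff_distrib)
  ultimately show ?case
    using g(1) hk_coord_mult by (intro exI[of _ "\<lambda>M. M i j * g M"]) (auto simp: abs_mult)
next
  case (hk_add t K f K' f')
  then obtain g g' where g: "pol d g" "\<And>M. orthogonal_real d M \<Longrightarrow> \<bar>g M\<bar> \<le> K" "dg d t (\<lambda>M. f M - g M)"
    "pol d g'" "\<And>M. orthogonal_real d M \<Longrightarrow> \<bar>g' M\<bar> \<le> K'" "dg d t (\<lambda>M. f' M - g' M)"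
    by blast
  have "dg d t (\<lambda>M. f M + f' M - (g M + g' M))"
    using dg_add[OF g(3,6)] by (simp add: algebra_simps)
  then show ?case
    using g by (intro exI[of _ "\<lambda>M. g M + g' M"]) (auto intro!: order_trans[OF abs_triangle_ineq] add_mono)
next
  case (hk_weaken t K f K')
  then show ?case by (meson order_trans)
next
  case (hk_cong t K f f')
  then obtain g where g: "pol d g" "\<And>M. orthogonal_real d M \<Longrightarrow> \<bar>g M\<bar> \<le> K" "dg d t (\<lambda>M. f M - g M)"
    by blast
  then show ?case using hk_cong
    by (intro exI[of _ g]) (auto intro: dg_cong[OF g(3)])
qed

text \<open>This is N_t. Modulo \<open>dg d t\<close> it acts on monomials of degree t as the sum,
  over ordered pairs of factors, of the exchange of their row indices; hence the count t (t -
  1).\<close>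

definition Nop :: "nat \<Rightarrow> nat \<Rightarrow> (rmat \<Rightarrow> real) \<Rightarrow> rmat \<Rightarrow> real" where
  "Nop d t f M = Lap d f M - real t * (real d - 1) * f M"

text \<open>Both bounds go through one induction, because N applied to \<open>M i j * f M\<close>
  produces -2 times \<open>Gam\<close> of the new coordinate with f. \<open>Gam\<close> with a
  coordinate exchanges it with each of the t factors, giving t; then t (t - 1) + 2 t = (t + 1)
  t.\<close>

lemma hk_Gam_Nop:
  assumes "hk d t K f"
  shows "(\<forall>k l. k < d \<longrightarrow> l < d \<longrightarrow> hk d (Suc t) (real t * K) (Gam d (\<lambda>M. M k l) f)) \<and>
         hk d t (real t * (real t - 1) * K) (Nop d t f)"
  using assms
proof (induction rule: hk.induct)
  case (hk_low t f)
  then show ?case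
    by (auto simp: Nop_def[abs_def] intro!: hk.hk_low dg_Gam_coord dg_diff dg_Lap dg_cmult)
next
  case (hk_const c)
  then show ?case by (auto simp: Nop_def[abs_def] intro!: hk.hk_low dg_zero)
next
  case (hk_coord_mult t K f i j)
  note f = hk_pol[OF hk_coord_mult.hyps(1)] and K = hk_nonneg[OF hk_coord_mult.hyps(1)]
  have G: "hk d (Suc (Suc t)) (real (Suc t) * K) (Gam d (\<lambda>M. M k l) (\<lambda>M. M i j * f M))"
    if kl: "k < d" "l < d" for k l
  proof -
    have 1: "hk d (Suc (Suc t)) (real t * K) (\<lambda>M. M i j * Gam d (\<lambda>M. M k l) f M)"
      using hk_coord_mult kl by (intro hk.hk_coord_mult) auto
    \<comment> \<open>The diagonal term loses two degrees, so it costs nothing in the coefficient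
      count.\<close>
    have 2: "hk d (Suc (Suc t)) 0 (\<lambda>M. (if k = i \<and> l = j then 1 else 0) * f M)"
      using hk_dg[OF hk_coord_mult.hyps(1)] by (intro hk.hk_low dg_cmult) simp
    have 3: "hk d (Suc (Suc t)) (\<bar>-1\<bar> * K) (\<lambda>M. - 1 * (M i l * (M k j * f M)))"
      using hk_coord_mult kl by (intro hk_cmult hk.hk_coord_mult) auto
    have "hk d (Suc (Suc t)) ((real t * K + 0) + \<bar>-1\<bar> * K) (Gam d (\<lambda>M. M k l) (\<lambda>M. M i j * f M))"
    proof (rule hk_cong[OF hk_add[OF hk_add[OF 1 2] 3]])
      show "pol d (Gam d (\<lambda>M. M k l) (\<lambda>M. M i j * f M))"
        using f kl hk_coord_mult by auto
      fix M assume M: "orthogonal_real d M"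
      show "M i j * Gam d (\<lambda>M. M k l) f M + (if k = i \<and> l = j then 1 else 0) * f M + - 1 * (M i l * (M k j * f M))
        = Gam d (\<lambda>M. M k l) (\<lambda>M. M i j * f M) M"
        using f kl hk_coord_mult by (simp add: Gam_mult Gam_coord[OF M] algebra_simps)
    qed
    then show ?thesis by (simp add: distrib_right add.commute)
  qed
  have 1: "hk d (Suc t) (real t * (real t - 1) * K) (\<lambda>M. M i j * Nop d t f M)"
    using hk_coord_mult by (intro hk.hk_coord_mult) auto
  have 2: "hk d (Suc t) (\<bar>-2\<bar> * (real t * K)) (\<lambda>M. - 2 * Gam d (\<lambda>M. M i j) f M)"
    using hk_coord_mult by (intro hk_cmult) auto
  have "hk d (Suc t) (real t * (real t - 1) * K + \<bar>-2\<bar> * (real t * K)) (Nop d (Suc t) (\<lambda>M. M i j * f M))"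
  proof (rule hk_cong[OF hk_add[OF 1 2]])
    show "pol d (Nop d (Suc t) (\<lambda>M. M i j * f M))"
      using f hk_coord_mult by (auto simp: Nop_def[abs_def])
  qed (use f hk_coord_mult in \<open>simp add: Nop_def Lap_mult Lap_coord Gam_commute[of d f] algebra_simps\<close>)
  also have "real t * (real t - 1) * K + \<bar>-2\<bar> * (real t * K) = real (Suc t) * (real (Suc t) - 1) * K"
    by (simp add: algebra_simps)
  finally show ?case using G by blast
next
  case (hk_add t K f K' g)
  note pol = hk_pol[OF hk_add.hyps(1)] hk_pol[OF hk_add.hyps(2)]
  have "hk d (Suc t) (real t * K + real t * K') (Gam d (\<lambda>M. M k l) (\<lambda>M. f M + g M))"
    if "k < d" "l < d" for k l
    using hk_add that pol by (auto simp: Gam_add intro!: hk.hk_add)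
  moreover have "hk d t (real t * (real t - 1) * K + real t * (real t - 1) * K') (Nop d t (\<lambda>M. f M + g M))"
  proof (rule hk_cong)
    show "hk d t (real t * (real t - 1) * K + real t * (real t - 1) * K') (\<lambda>M. Nop d t f M + Nop d t g M)"
      using hk_add by (intro hk.hk_add) auto
  qed (use pol in \<open>auto simp: Nop_def[abs_def] Lap_add algebra_simps\<close>)
  ultimately show ?case by (simp add: distrib_left)
next
  case (hk_weaken t K f K')
  have "0 \<le> real t * (real t - 1)" by (cases t) auto
  then have "real t * (real t - 1) * K \<le> real t * (real t - 1) * K'" "real t * K \<le> real t * K'"
    using hk_weaken.hyps by (auto intro: mult_left_mono)
  then show ?case using hk_weaken.IH hk.hk_weaken by blast
next
  case (hk_cong t K f g)
  have "hk d (Suc t) (real t * K) (Gam d (\<lambda>M. M k l) g)" if "k < d" "l < d" for k l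
    using hk_cong that
    by (intro hk.hk_cong[of d _ _ "Gam d (\<lambda>M. M k l) f" "Gam d (\<lambda>M. M k l) g"]) (auto intro: Gam_cong)
  moreover have "hk d t (real t * (real t - 1) * K) (Nop d t g)"
    using hk_cong Lap_cong[of d f g]
    by (intro hk.hk_cong[of d _ _ "Nop d t f" "Nop d t g"]) (auto simp: Nop_def[abs_def])
  ultimately show ?case by blast
qed

lemmas hk_Nop = hk_Gam_Nop[THEN conjunct2]

section \<open>Orthogonal components\<close>

text \<open>The successive ratios of a log-convex sequence increase, so a first ratio above q would
  force growth beyond every C q^k.\<close>

lemma log_convex_seq_ratio:
  fixes a :: "nat \<Rightarrow> real"
  assumes nonneg: "\<And>k. 0 \<le> a k" and convex: "\<And>k. (a (Suc k))\<^sup>2 \<le> a k * a (Suc (Suc k))"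
    and bound: "\<And>k. a k \<le> C * q ^ k" and q: "0 \<le> q"
  shows "a 1 \<le> q * a 0"
proof (cases "a 0 = 0")
  case True
  then show ?thesis using convex[of 0] by simp
next
  case False
  then have a0: "a 0 > 0" using nonneg[of 0] by simp
  show ?thesis
  proof (rule ccontr)
    assume neg: "\<not> a 1 \<le> q * a 0"
    define r where "r = a 1 / a 0"
    have r: "r > q" using neg a0 by (simp add: r_def field_simps)
    have step: "0 < a k \<and> r * a k \<le> a (Suc k)" for k
    proof (induction k)
      case 0
      then show ?case using a0 by (simp add: r_def)
    next
      case (Suc k)
      have pos: "0 < a (Suc k)" using Suc r q by (smt (verit) mult_pos_pos)
      have "a k * (r * a (Suc k)) \<le> (a (Suc k))\<^sup>2"
        using mult_right_mono[of "r * a k" "a (Suc k)" "a (Suc k)"] Suc pos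
        by (simp add: power2_eq_square mult_ac)
      also have "\<dots> \<le> a k * a (Suc (Suc k))" by (rule convex)
      finally show ?case using Suc pos by simp
    qed
    have low: "r ^ k * a 0 \<le> a k" for k
    proof (induction k)
      case (Suc k)
      have "r * (r ^ k * a 0) \<le> r * a k" using Suc r q by (intro mult_left_mono) auto
      then show ?case using step[of k] by (simp add: mult.assoc)
    qed simp
    show False
    proof (cases "q = 0")
      case True
      then show False using bound[of 1] step[of 1] by simp
    next
      case False
      then have q: "q > 0" using q by simp
      then obtain k where k: "C / a 0 < (r / q) ^ k"
        using real_arch_pow[of "r / q"] r by auto
      have "(r / q) ^ k \<le> C / a 0"
        using order_trans[OF low[of k] bound[of k]] q a0 by (simp add: field_simps power_divide)
      then show False using k by simp
    qed
  qed
qed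

text \<open>A finite generating set of \<open>dg d n\<close> up to values on O(d), with the same
  index shift: the constant 1 enters at index 2, and 0 fills its place at higher indices. Finiteness
  is what makes orthogonal projections available without completeness.\<close>

fun gens :: "nat \<Rightarrow> nat \<Rightarrow> (rmat \<Rightarrow> real) set" where
  "gens d 0 = {}"
| "gens d (Suc 0) = {}"
| "gens d (Suc (Suc n)) = {\<lambda>_. if n = 0 then 1 else 0} \<union>
     (\<Union>i<d. \<Union>j<d. (\<lambda>b M. M i j * b M) ` gens d (Suc n)) \<union> gens d n"

lemma finite_gens: "finite (gens d n)"
  by (induction d n rule: gens.induct) auto

lemma gens_dg: "b \<in> gens d n \<Longrightarrow> dg d n b"
proof (induction d n arbitrary: b rule: gens.induct)
  case (3 d n)
  then show ?case
    by (cases "n = 0") (auto intro: dg_zero dg_lower dg_coord_mult dg_const[unfolded numeral_2_eq_2])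
qed auto

section \<open>Inner product, projections and the norm of N\<close>

context orth_haar
begin

definition ip :: "(rmat \<Rightarrow> real) \<Rightarrow> (rmat \<Rightarrow> real) \<Rightarrow> real" where
  "ip f g = E (\<lambda>M. f M * g M)"

lemma ip_commute: "ip f g = ip g f"
  by (simp add: ip_def mult.commute)

lemma ip_add_left: "pol d f \<Longrightarrow> pol d g \<Longrightarrow> pol d h \<Longrightarrow> ip (\<lambda>M. f M + g M) h = ip f h + ip g h"
  by (simp add: ip_def distrib_right)

lemma ip_diff_left: "pol d f \<Longrightarrow> pol d g \<Longrightarrow> pol d h \<Longrightarrow> ip (\<lambda>M. f M - g M) h = ip f h - ip g h"
  by (simp add: ip_def left_diff_distrib)

lemma ip_cmult_left: "ip (\<lambda>M. c * f M) g = c * ip f g"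
  by (simp add: ip_def mult.assoc)

lemma ip_add_right: "pol d f \<Longrightarrow> pol d g \<Longrightarrow> pol d h \<Longrightarrow> ip h (\<lambda>M. f M + g M) = ip h f + ip h g"
  by (simp add: ip_def distrib_left)

lemma ip_diff_right: "pol d f \<Longrightarrow> pol d g \<Longrightarrow> pol d h \<Longrightarrow> ip h (\<lambda>M. f M - g M) = ip h f - ip h g"
  by (simp add: ip_def right_diff_distrib)

lemma ip_cmult_right: "ip g (\<lambda>M. c * f M) = c * ip g f"
  by (simp add: ip_def mult.left_commute)

lemmas ip_linear = ip_add_left ip_diff_left ip_cmult_left ip_add_right ip_diff_right ip_cmult_right

lemma ip_mult_left: "ip (\<lambda>M. f M * g M) h = ip g (\<lambda>M. f M * h M)"
  by (simp add: ip_def mult.left_commute mult.commute)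

lemma ip_zero [simp]: "ip f (\<lambda>_. 0) = 0" "ip (\<lambda>_. 0) f = 0"
  by (simp_all add: ip_def)

lemma ip_nonneg: "0 \<le> ip f f"
  by (simp add: ip_def)

lemma ip_cong:
  assumes "pol d f" "pol d f'" "pol d g" "pol d g'"
    "\<And>M. orthogonal_real d M \<Longrightarrow> f M = f' M" "\<And>M. orthogonal_real d M \<Longrightarrow> g M = g' M"
  shows "ip f g = ip f' g'"
  unfolding ip_def using assms by (intro E_cong) auto

lemma ip_Cauchy_Schwarz:
  assumes "pol d f" "pol d g"
  shows "(ip f g)\<^sup>2 \<le> ip f f * ip g g"
proof -
  have key: "0 \<le> ip f f - 2 * c * ip f g + c\<^sup>2 * ip g g" for c
  proof -
    have "0 \<le> ip (\<lambda>M. f M - c * g M) (\<lambda>M. f M - c * g M)" by (rule ip_nonneg)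
    also have "\<dots> = ip f f - 2 * c * ip f g + c\<^sup>2 * ip g g"
      using assms by (simp add: ip_linear ip_commute[of g f] power2_eq_square algebra_simps)
    finally show ?thesis .
  qed
  show ?thesis
  proof (cases "ip g g = 0")
    case True
    show ?thesis
    proof (cases "ip f g = 0")
      case False
      then have "0 \<le> ip f f - (ip f f + 1)"
        using key[of "(ip f f + 1) / (2 * ip f g)"] True by simp
      then show ?thesis by simp
    qed (use True in simp)
  next
    case False
    then have "ip g g > 0" using ip_nonneg[of g] by linarith
    then show ?thesis
      using key[of "ip f g / ip g g"] by (simp add: field_simps power2_eq_square)
  qed
qed

lemma ip_null: "pol d f \<Longrightarrow> pol d g \<Longrightarrow> ip g g = 0 \<Longrightarrow> ip f g = 0"
  using ip_Cauchy_Schwarz[of f g] by simp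

lemma ip_AM_GM:
  assumes "pol d f" "pol d g" "c > 0"
  shows "2 * \<bar>ip f g\<bar> \<le> c * ip f f + ip g g / c"
proof -
  have key: "0 \<le> c * ip f f - 2 * s * ip f g + ip g g / c" if s: "s\<^sup>2 = 1" for s
  proof -
    have "0 \<le> ip (\<lambda>M. c * f M - s * g M) (\<lambda>M. c * f M - s * g M)" by (rule ip_nonneg)
    also have "\<dots> = c\<^sup>2 * ip f f - 2 * c * s * ip f g + s\<^sup>2 * ip g g"
      using assms by (simp add: ip_linear ip_commute[of g f] power2_eq_square algebra_simps)
    also have "\<dots> = c * (c * ip f f - 2 * s * ip f g + ip g g / c)"
      using assms(3) s by (simp add: field_simps power2_eq_square)
    finally show ?thesis using assms(3) by (simp add: zero_le_mult_iff)
  qed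
  show ?thesis using key[of 1] key[of "-1"] by (simp add: abs_if)
qed

text \<open>\<open>E_Dv\<close> applied to the product of f and \<open>Dv p g\<close>, summed over
  the planes.\<close>

lemma ip_Lap:
  assumes "pol d f" "pol d g"
  shows "ip f (Lap d g) = E (Gam d f g)"
proof -
  have "E (\<lambda>M. f M * Dv p (Dv p g) M) = - E (\<lambda>M. Dv p f M * Dv p g M)" if p: "p \<in> planes d" for p
  proof -
    have "E (Dv p (\<lambda>M. f M * Dv p g M)) = 0"
      using assms p by (intro E_Dv) auto
    then show ?thesis using assms p by (simp add: Dv_mult mult.commute)
  qed
  then show ?thesis using assms
    by (simp add: ip_def Lap_def Gam_def[abs_def] sum_distrib_left sum_negf Bochner_Integration.integral_sum)
qed

lemma Lap_symmetric: "pol d f \<Longrightarrow> pol d g \<Longrightarrow> ip (Lap d f) g = ip f (Lap d g)"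
  by (simp add: ip_commute[of "Lap d f"] ip_Lap Gam_commute)

text \<open>As \<open>dg\<close> descends in steps of two, this concerns degrees of one
  parity.\<close>

definition perp :: "nat \<Rightarrow> (rmat \<Rightarrow> real) \<Rightarrow> bool" where
  "perp n f \<longleftrightarrow> (\<forall>w. dg d n w \<longrightarrow> ip f w = 0)"

text \<open>The induction generalises over g, so that multiplication by a coordinate can be moved
  from w to g.\<close>

lemma gens_generate:
  assumes "dg d n w" "pol d g" "\<And>b. b \<in> gens d n \<Longrightarrow> ip g b = 0"
  shows "ip g w = 0"
  using assms
proof (induction arbitrary: g rule: dg.induct)
  case (dg_const c)
  then have "ip g (\<lambda>_. 1) = 0" by (simp add: numeral_2_eq_2)
  then show ?case using ip_cmult_right[of g c "\<lambda>_. 1"] by simp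
next
  case (dg_coord_mult n f i j)
  show ?case
  proof (cases n)
    case 0
    then have "ip g (\<lambda>M. M i j * f M) = ip g (\<lambda>_. 0)"
      using dg_coord_mult dg_less_2_zero[OF dg_coord_mult.hyps(1)] dg_pol by (intro ip_cong) auto
    then show ?thesis by simp
  next
    case (Suc m)
    have "ip (\<lambda>M. M i j * g M) f = 0"
    proof (rule dg_coord_mult.IH)
      fix b assume "b \<in> gens d n"
      then have "(\<lambda>M. M i j * b M) \<in> gens d (Suc n)" using Suc dg_coord_mult.hyps by auto
      then show "ip (\<lambda>M. M i j * g M) b = 0"
        using dg_coord_mult.prems(2) by (simp add: ip_mult_left)
    qed (use dg_coord_mult in auto)
    then show ?thesis by (simp add: ip_mult_left)
  qed
next
  case (dg_add n f h)
  then show ?case by (simp add: ip_add_right dg_pol)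
next
  case (dg_cong n f h)
  then have "ip g h = ip g f" by (intro ip_cong) (auto simp: dg_pol)
  then show ?case using dg_cong by simp
qed auto

text \<open>The second conjunct expresses, without linear combinations, that \<open>v\<close> lies in the span of \<open>B\<close>.\<close>

lemma projection_finite:
  assumes "finite B" "\<And>b. b \<in> B \<Longrightarrow> dg d n b" "pol d f"
  shows "\<exists>v. dg d n v \<and> (\<forall>g. pol d g \<longrightarrow> (\<forall>b\<in>B. ip g b = 0) \<longrightarrow> ip g v = 0) \<and>
             (\<forall>b\<in>B. ip (\<lambda>M. f M - v M) b = 0)"
  using assms
proof (induction B arbitrary: f rule: finite_induct)
  case empty
  then show ?case by (auto intro!: exI[of _ "\<lambda>_. 0"] dg_zero)
next
  case (insert b B)
  have IH: "\<exists>v. dg d n v \<and> (\<forall>g. pol d g \<longrightarrow> (\<forall>b\<in>B. ip g b = 0) \<longrightarrow> ip g v = 0) \<and>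
             (\<forall>b\<in>B. ip (\<lambda>M. f M - v M) b = 0)" if "pol d f" for f
    by (rule insert.IH[OF _ that]) (use insert.prems in auto)
  have "pol d b" using insert.prems dg_pol by blast
  from IH[OF this] obtain vb where vb: "dg d n vb"
    "\<forall>g. pol d g \<longrightarrow> (\<forall>b\<in>B. ip g b = 0) \<longrightarrow> ip g vb = 0"
    "\<forall>b'\<in>B. ip (\<lambda>M. b M - vb M) b' = 0"
    by (elim exE conjE)
  from IH[OF \<open>pol d f\<close>] obtain vf where vf: "dg d n vf"
    "\<forall>g. pol d g \<longrightarrow> (\<forall>b\<in>B. ip g b = 0) \<longrightarrow> ip g vf = 0"
    "\<forall>b'\<in>B. ip (\<lambda>M. f M - vf M) b' = 0"
    by (elim exE conjE)
  note vb = vb(1) vb(2,3)[rule_format] and vf = vf(1) vf(2,3)[rule_format]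
  define b0 where "b0 = (\<lambda>M. b M - vb M)"
  define f0 where "f0 = (\<lambda>M. f M - vf M)"
  \<comment> \<open>One Gram-Schmidt step. If \<open>b0\<close> is a null function, division by zero
    gives c = 0, which is right because \<open>ip f0 b0\<close> then vanishes by
    \<open>ip_null\<close>.\<close>
  define c where "c = ip f0 b0 / ip b0 b0"
  define v where "v = (\<lambda>M. vf M + c * b0 M)"
  have pB: "pol d b'" if "b' \<in> insert b B" for b' using insert.prems that dg_pol by blast
  have pols: "pol d vb" "pol d vf" "pol d b" "pol d b0" "pol d f0" "pol d f"
    using vb vf insert.prems dg_pol pB by (auto simp: b0_def f0_def)
  have dgb0: "dg d n b0" using insert.prems vb by (simp add: b0_def dg_diff)
  have fv: "(\<lambda>M. f M - v M) = (\<lambda>M. f0 M - c * b0 M)" by (auto simp: v_def f0_def)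
  have perpB: "ip (\<lambda>M. f M - v M) b' = 0" if "b' \<in> B" for b'
    unfolding fv using vb(3)[OF that] vf(3)[OF that] pols pB that
    by (simp add: ip_linear flip: b0_def f0_def)
  have "ip (\<lambda>M. f M - v M) b = ip (\<lambda>M. f M - v M) b0 + ip (\<lambda>M. f M - v M) vb"
    using pols by (simp add: ip_add_right[symmetric] fv) (simp add: b0_def)
  also have "ip (\<lambda>M. f M - v M) vb = 0"
    using perpB pols by (intro vb(2)) (auto simp: fv)
  also have "ip (\<lambda>M. f M - v M) b0 = ip f0 b0 - c * ip b0 b0"
    using pols by (simp add: fv ip_linear)
  also have "\<dots> = 0"
    using pols ip_null[of f0 b0] by (cases "ip b0 b0 = 0") (simp_all add: c_def)
  finally have "ip (\<lambda>M. f M - v M) b = 0" by simp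
  moreover have "ip g v = 0" if "pol d g" "\<forall>b\<in>insert b B. ip g b = 0" for g
  proof -
    have "ip g vf = 0" "ip g vb = 0" using vf(2) vb(2) that by auto
    then show ?thesis using that pols by (simp add: v_def ip_linear) (simp add: b0_def ip_linear)
  qed
  moreover have "dg d n v" unfolding v_def by (intro dg_add vf dg_cmult dgb0)
  ultimately show ?case using perpB by (intro exI[of _ v]) auto
qed

lemma projection_ex:
  assumes "pol d f"
  obtains v where "dg d n v" "perp n (\<lambda>M. f M - v M)"
proof -
  obtain v where v: "dg d n v" "\<forall>b\<in>gens d n. ip (\<lambda>M. f M - v M) b = 0"
    using projection_finite[OF finite_gens gens_dg assms, of d n] by blast
  then have "perp n (\<lambda>M. f M - v M)"
    unfolding perp_def using gens_generate assms dg_pol by auto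
  with v that show thesis by blast
qed

definition V :: "nat \<Rightarrow> (rmat \<Rightarrow> real) \<Rightarrow> bool" where
  "V t h \<longleftrightarrow> dg d (t + 2) h \<and> perp t h"

lemma V_pol: "V t h \<Longrightarrow> pol d h"
  by (auto simp: V_def dg_pol)

lemma pol_Nop [intro, simp]: "pol d f \<Longrightarrow> pol d (Nop d t f)"
  unfolding Nop_def[abs_def] by auto

lemma dg_Nop: "dg d n f \<Longrightarrow> dg d n (Nop d t f)"
  unfolding Nop_def[abs_def] by (intro dg_diff dg_Lap dg_cmult)

lemma Nop_symmetric:
  assumes "pol d f" "pol d g"
  shows "ip (Nop d t f) g = ip f (Nop d t g)"
  unfolding Nop_def[abs_def] using assms
  by (simp add: ip_linear Lap_symmetric)

lemma V_Nop: "V t h \<Longrightarrow> V t (Nop d t h)"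
  by (auto simp: V_def perp_def dg_Nop Nop_symmetric dg_pol)

text \<open>The coefficient bound gives \<open>N\<^sup>k h\<close> only the norm \<open>\<tau>\<^sup>k K\<close> with \<open>K\<close> depending on \<open>h\<close>; as \<open>N\<close> is symmetric,
  the squared norms are log-convex in \<open>k\<close>, and this removes \<open>K\<close>.\<close>

lemma Nop_norm_le:
  assumes h: "V t h"
  shows "ip (Nop d t h) (Nop d t h) \<le> (real t * (real t - 1))\<^sup>2 * ip h h"
proof -
  define \<tau> where "\<tau> = real t * (real t - 1)"
  have \<tau>: "0 \<le> \<tau>" by (cases t) (auto simp: \<tau>_def)
  define hh where "hh = (\<lambda>k. (Nop d t ^^ k) h)"
  have hh_Suc: "hh (Suc k) = Nop d t (hh k)" for k by (simp add: hh_def)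
  have V: "V t (hh k)" for k by (induction k) (auto simp: hh_Suc V_Nop, simp add: hh_def h)
  note pols = V_pol[OF V]
  obtain K where K: "hk d t K h" using dg_hk[of d "t + 2" h t] h by (auto simp: V_def)
  have hkk: "hk d t (\<tau> ^ k * K) (hh k)" for k
  proof (induction k)
    case (Suc k)
    then show ?case using hk_Nop[OF Suc] by (simp add: hh_Suc \<tau>_def mult.assoc)
  qed (simp add: hh_def K)
  have "ip (Nop d t h) (Nop d t h) \<le> \<tau>\<^sup>2 * ip h h"
  proof -
    define a where "a = (\<lambda>k. ip (hh k) (hh k))"
    have "a 1 \<le> \<tau>\<^sup>2 * a 0"
    proof (rule log_convex_seq_ratio)
      show "0 \<le> a k" for k by (simp add: a_def ip_nonneg)
      show "(a (Suc k))\<^sup>2 \<le> a k * a (Suc (Suc k))" for k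
      proof -
        have "a (Suc k) = ip (hh k) (hh (Suc (Suc k)))"
          using pols Nop_symmetric[of "hh k" "hh (Suc k)" t] by (simp add: a_def hh_Suc)
        then show ?thesis unfolding a_def using ip_Cauchy_Schwarz[OF pols pols] by simp
      qed
      show "a k \<le> K\<^sup>2 * (\<tau>\<^sup>2) ^ k" for k
      proof -
        obtain g where g: "pol d g" "\<And>M. orthogonal_real d M \<Longrightarrow> \<bar>g M\<bar> \<le> \<tau> ^ k * K" "dg d t (\<lambda>M. hh k M - g M)"
          using hk_split[OF hkk[of k]] by blast
        \<comment> \<open>The difference has lower degree, to which \<open>hh k\<close> is
          orthogonal; so only the sup norm of g matters.\<close>
        have "ip (hh k) (\<lambda>M. hh k M - g M) = 0"
          using V[of k] g(3) by (auto simp: V_def perp_def)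
        then have eq: "a k = ip (hh k) g" using pols g(1) by (simp add: a_def ip_linear)
        have "ip g g \<le> E (\<lambda>_. (\<tau> ^ k * K)\<^sup>2)"
          unfolding ip_def
        proof (rule E_mono)
          fix M assume "orthogonal_real d M"
          then have "\<bar>g M\<bar>\<^sup>2 \<le> (\<tau> ^ k * K)\<^sup>2" using g(2) by (intro power_mono) auto
          then show "g M * g M \<le> (\<tau> ^ k * K)\<^sup>2" by (simp add: power2_eq_square)
        qed (use g in auto)
        then have gg: "ip g g \<le> K\<^sup>2 * (\<tau>\<^sup>2) ^ k"
          by (simp add: power_mult_distrib prob_space mult.commute power_mult[symmetric])
        have "(a k)\<^sup>2 \<le> a k * ip g g" unfolding eq using ip_Cauchy_Schwarz[OF pols g(1), of k] eq
          by (simp add: a_def)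
        then have "a k \<le> ip g g"
          using ip_nonneg[of "hh k"] ip_nonneg[of g] by (cases "a k = 0") (auto simp: power2_eq_square a_def)
        with gg show ?thesis by linarith
      qed
    qed simp
    then show ?thesis by (simp add: a_def hh_def)
  qed
  then show ?thesis by (simp add: \<tau>_def)
qed

lemma abs_ip_Nop_le:
  assumes h: "V t h"
  shows "\<bar>ip h (Nop d t h)\<bar> \<le> real t * (real t - 1) * ip h h"
proof (rule abs_le_square_iff[THEN iffD2, THEN order_trans])
  have \<tau>: "0 \<le> real t * (real t - 1)" by (cases t) auto
  show "\<bar>real t * (real t - 1) * ip h h\<bar> \<le> real t * (real t - 1) * ip h h"
    using \<tau> ip_nonneg[of h] by (simp only: abs_of_nonneg mult_nonneg_nonneg)
  have "(ip h (Nop d t h))\<^sup>2 \<le> ip h h * ip (Nop d t h) (Nop d t h)"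
    using V_pol[OF h] by (intro ip_Cauchy_Schwarz) auto
  also have "\<dots> \<le> ip h h * ((real t * (real t - 1))\<^sup>2 * ip h h)"
    using Nop_norm_le[OF h] ip_nonneg by (intro mult_left_mono)
  finally show "(ip h (Nop d t h))\<^sup>2 \<le> (real t * (real t - 1) * ip h h)\<^sup>2"
    by (simp add: power2_eq_square mult_ac)
qed

end

section \<open>Linear forms\<close>

definition lin :: "nat \<Rightarrow> rmat \<Rightarrow> rmat \<Rightarrow> real" where
  "lin d A M = (\<Sum>i<d. \<Sum>j<d. A i j * M i j)"

definition sqn :: "nat \<Rightarrow> rmat \<Rightarrow> real" where
  "sqn d A = (\<Sum>i<d. \<Sum>j<d. (A i j)\<^sup>2)"

text \<open>\<open>Mt d A a k M\<close> is the entry \<open>(a, k)\<close> of \<open>M A\<^sup>t\<close>, and \<open>trace_sq\<close> is the trace of its square.\<close>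

definition Mt :: "nat \<Rightarrow> rmat \<Rightarrow> nat \<Rightarrow> nat \<Rightarrow> rmat \<Rightarrow> real" where
  "Mt d A a k M = (\<Sum>j<d. A k j * M a j)"

definition trace_sq :: "nat \<Rightarrow> rmat \<Rightarrow> rmat \<Rightarrow> real" where
  "trace_sq d A M = (\<Sum>i<d. \<Sum>k<d. Mt d A k i M * Mt d A i k M)"

lemma lin_eq_trace: "lin d A = (\<lambda>M. \<Sum>a<d. Mt d A a a M)"
  by (simp add: lin_def Mt_def fun_eq_iff)

lemma pol_Mt [intro, simp]: "a < d \<Longrightarrow> pol d (Mt d A a k)"
  unfolding Mt_def[abs_def] by auto

lemma pol_lin [intro, simp]: "pol d (lin d A)"
  unfolding lin_eq_trace by auto

lemma pol_trace_sq [intro, simp]: "pol d (trace_sq d A)"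
  unfolding trace_sq_def[abs_def] by (auto intro!: pol_sum)

lemma dg_lin_mult: "dg d n f \<Longrightarrow> dg d (Suc n) (\<lambda>M. lin d A M * f M)"
  unfolding lin_def sum_distrib_right mult.assoc
  by (intro dg_sum dg_cmult dg_coord_mult) auto

lemma Gam_Mt:
  assumes "orthogonal_real d M" "a < d" "b < d"
  shows "Gam d (Mt d A a k) (Mt d A b l) M =
    (if a = b then \<Sum>j<d. A k j * A l j else 0) - Mt d A b k M * Mt d A a l M"
proof -
  have expand: "Gam d f (Mt d A b l) = (\<lambda>M. \<Sum>j<d. A l j * Gam d f (\<lambda>M. M b j) M)" if "b < d" for f b l
    unfolding Mt_def[abs_def] using that by (simp add: Gam_sum Gam_cmult)
  have "Gam d (Mt d A a k) (Mt d A b l) M =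
      (\<Sum>j'<d. A l j' * (\<Sum>j<d. A k j * Gam d (\<lambda>M. M b j') (\<lambda>M. M a j) M))"
    unfolding expand[OF assms(3)]
  proof (intro sum.cong refl)
    fix j'
    show "A l j' * Gam d (Mt d A a k) (\<lambda>M. M b j') M = A l j' * (\<Sum>j<d. A k j * Gam d (\<lambda>M. M b j') (\<lambda>M. M a j) M)"
      unfolding Gam_commute[of d "Mt d A a k"] expand[OF assms(2)] ..
  qed
  also have "\<dots> = (\<Sum>j'<d. \<Sum>j<d. (if a = b \<and> j = j' then A l j' * A k j else 0) -
      (A k j * M b j) * (A l j' * M a j'))"
    using assms unfolding sum_distrib_left
    by (intro sum.cong refl) (auto simp: Gam_coord algebra_simps)
  also have "\<dots> = (\<Sum>j'<d. \<Sum>j<d. (if a = b \<and> j = j' then A l j' * A k j else 0)) - Mt d A b k M * Mt d A a l M"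
    unfolding sum_subtractf Mt_def sum_product by (subst (3) sum.swap) simp
  also have "(\<Sum>j'<d. \<Sum>j<d. (if a = b \<and> j = j' then A l j' * A k j else 0)) =
      (if a = b then \<Sum>j<d. A k j * A l j else 0)"
    by (cases "a = b") (auto intro!: sum.cong simp: mult.commute)
  finally show ?thesis .
qed

lemma Lap_Mt: "a < d \<Longrightarrow> Lap d (Mt d A a k) = (\<lambda>M. (real d - 1) * Mt d A a k M)"
  unfolding Mt_def[abs_def]
  by (simp add: Lap_sum Lap_cmult Lap_coord sum_distrib_left mult.left_commute)

lemma Dv_Mt:
  assumes "p \<in> planes d" "a < d"
  shows "Dv p (Mt d A a k) =
    (\<lambda>M. if a = fst p then - Mt d A (snd p) k M else if a = snd p then Mt d A (fst p) k M else 0)"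
  unfolding Mt_def[abs_def] using assms
  by (simp add: Dv_sum Dv_cmult Dv_coord fun_eq_iff sum_negf)

lemma sum_Mt_sq:
  assumes "orthogonal_real d M"
  shows "(\<Sum>a<d. \<Sum>k<d. (Mt d A a k M)\<^sup>2) = sqn d A"
proof -
  have "(\<Sum>a<d. (Mt d A a k M)\<^sup>2) = (\<Sum>j<d. (A k j)\<^sup>2)" for k
  proof -
    have "(\<Sum>a<d. (Mt d A a k M)\<^sup>2) = (\<Sum>a<d. \<Sum>j<d. \<Sum>l<d. A k j * A k l * (M a j * M a l))"
      by (simp add: Mt_def power2_eq_square sum_product mult_ac)
    also have "\<dots> = (\<Sum>j<d. \<Sum>l<d. \<Sum>a<d. A k j * A k l * (M a j * M a l))"
      by (subst sum.swap, subst (2) sum.swap) (rule refl)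
    also have "\<dots> = (\<Sum>j<d. \<Sum>l<d. if j = l then A k j * A k l else 0)"
      using assms by (intro sum.cong refl) (auto simp: sum_distrib_left[symmetric] orthogonal_real_def)
    finally show ?thesis by (simp add: power2_eq_square)
  qed
  then show ?thesis unfolding sqn_def by (subst sum.swap) simp
qed

lemma Gam_lin:
  assumes "orthogonal_real d M"
  shows "Gam d (lin d A) (lin d A) M = sqn d A - trace_sq d A M"
proof -
  have expand: "Gam d f (lin d A) = (\<lambda>M. \<Sum>a<d. Gam d f (Mt d A a a) M)" for f
    unfolding lin_eq_trace by (simp add: Gam_sum)
  have "Gam d (lin d A) (lin d A) M = (\<Sum>a<d. \<Sum>b<d. Gam d (Mt d A a a) (Mt d A b b) M)"
    unfolding expand[of "lin d A"] Gam_commute[of d "lin d A"] expand ..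
  also have "\<dots> = (\<Sum>a<d. \<Sum>b<d. (if a = b then \<Sum>j<d. A a j * A b j else 0) - Mt d A b a M * Mt d A a b M)"
    using assms by (intro sum.cong refl) (simp add: Gam_Mt)
  also have "\<dots> = sqn d A - trace_sq d A M"
    by (simp add: sum_subtractf sqn_def trace_sq_def power2_eq_square mult.commute)
  finally show ?thesis .
qed

text \<open>The trace is nearly an eigenfunction with eigenvalue 2 (d - 1). Averages against it can
  therefore be taken by parts, with a gain of 1 / d.\<close>

lemma Lap_trace_sq:
  assumes "orthogonal_real d M"
  shows "Lap d (trace_sq d A) M = 2 * (real d - 1) * trace_sq d A M + 2 * (lin d A M)\<^sup>2 - 2 * sqn d A"
proof -
  have "Lap d (trace_sq d A) M = (\<Sum>i<d. \<Sum>k<d. 2 * (real d - 1) * (Mt d A k i M * Mt d A i k M) -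
      2 * Gam d (Mt d A i k) (Mt d A k i) M)"
    unfolding trace_sq_def[abs_def]
    by (simp add: Lap_sum Lap_mult Lap_Mt algebra_simps)
  also have "\<dots> = (\<Sum>i<d. \<Sum>k<d. 2 * (real d - 1) * (Mt d A k i M * Mt d A i k M) +
      2 * (Mt d A i i M * Mt d A k k M) - 2 * (if k = i then \<Sum>j<d. A i j * A k j else 0))"
    using assms by (intro sum.cong refl) (auto simp: Gam_Mt algebra_simps)
  also have "\<dots> = 2 * (real d - 1) * trace_sq d A M + 2 * (lin d A M)\<^sup>2 - 2 * sqn d A"
    by (simp add: sum_subtractf sum.distrib sum_distrib_left[symmetric] trace_sq_def lin_eq_trace
        power2_eq_square sum_product sqn_def)
  finally show ?thesis .
qed

lemma abs_trace_sq_le: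
  assumes "orthogonal_real d M"
  shows "\<bar>trace_sq d A M\<bar> \<le> sqn d A"
proof -
  have "\<bar>trace_sq d A M\<bar> \<le> (\<Sum>i<d. \<Sum>k<d. \<bar>Mt d A k i M * Mt d A i k M\<bar>)"
    unfolding trace_sq_def by (intro order_trans[OF sum_abs] sum_mono sum_abs)
  also have "\<dots> \<le> (\<Sum>i<d. \<Sum>k<d. ((Mt d A k i M)\<^sup>2 + (Mt d A i k M)\<^sup>2) / 2)"
  proof (intro sum_mono)
    fix i k
    show "\<bar>Mt d A k i M * Mt d A i k M\<bar> \<le> ((Mt d A k i M)\<^sup>2 + (Mt d A i k M)\<^sup>2) / 2"
      using sum_squares_bound[of "\<bar>Mt d A k i M\<bar>" "\<bar>Mt d A i k M\<bar>"] by (simp add: abs_mult)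
  qed
  also have "\<dots> = sqn d A"
  proof -
    have "(\<Sum>i<d. \<Sum>k<d. (Mt d A k i M)\<^sup>2) = sqn d A"
      by (subst sum.swap) (rule sum_Mt_sq[OF assms])
    then show ?thesis
      using sum_Mt_sq[OF assms, of A] by (simp add: sum_divide_distrib[symmetric] sum.distrib)
  qed
  finally show ?thesis .
qed

text \<open>Cauchy-Schwarz on the diagonal of M A^t. This crude bound starts the iteration in
  \<open>up_bound_limit\<close>.\<close>

lemma lin_sq_le:
  assumes "orthogonal_real d M"
  shows "(lin d A M)\<^sup>2 \<le> real d * sqn d A"
proof -
  have "(lin d A M)\<^sup>2 \<le> (\<Sum>a<d. (1::real)\<^sup>2) * (\<Sum>a<d. (Mt d A a a M)\<^sup>2)"
    using Cauchy_Schwarz_ineq_sum[of "\<lambda>_. 1" "\<lambda>a. Mt d A a a M" "{..<d}"]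
    by (simp add: lin_eq_trace)
  also have "(\<Sum>a<d. (Mt d A a a M)\<^sup>2) \<le> (\<Sum>a<d. \<Sum>k<d. (Mt d A a k M)\<^sup>2)"
    by (intro sum_mono member_le_sum) auto
  finally show ?thesis by (simp add: sum_Mt_sq[OF assms] mult_left_mono)
qed

text \<open>The two orientations of all planes are distinct off-diagonal cells of the d x d
  square.\<close>

lemma sum_planes_sym_le:
  fixes R C :: "nat \<Rightarrow> real"
  assumes "\<And>a. 0 \<le> R a" "\<And>a. 0 \<le> C a"
  shows "(\<Sum>p\<in>planes d. R (fst p) * C (snd p) + R (snd p) * C (fst p)) \<le> (\<Sum>a<d. R a) * (\<Sum>a<d. C a)"
proof -
  have "(\<Sum>p\<in>planes d. R (fst p) * C (snd p) + R (snd p) * C (fst p)) =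
      (\<Sum>p\<in>planes d. R (fst p) * C (snd p)) + (\<Sum>p\<in>prod.swap ` planes d. R (fst p) * C (snd p))"
    by (subst sum.reindex) (auto simp: sum.distrib inj_on_def mult.commute)
  also have "\<dots> = (\<Sum>p\<in>planes d \<union> prod.swap ` planes d. R (fst p) * C (snd p))"
    by (rule sum.union_disjoint[symmetric]) (simp_all, auto simp: planes_def)
  also have "\<dots> \<le> (\<Sum>p\<in>{..<d} \<times> {..<d}. R (fst p) * C (snd p))"
    using assms by (intro sum_mono2) (auto simp: planes_def)
  also have "\<dots> = (\<Sum>a<d. R a) * (\<Sum>a<d. C a)"
    by (simp add: sum_product sum.cartesian_product case_prod_unfold)
  finally show ?thesis .
qed

text \<open>In the plane (a, b) the derivative is 2 (Y - X), with Y and X the entries (a, b) and (b,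
  a) of (M A^t)^2. Their squares are at most products of a squared row norm R and a squared column
  norm C of M A^t; each family sums to 1, so the bound is free of d.\<close>

lemma Gam_trace_sq_le:
  assumes M: "orthogonal_real d M" and A: "sqn d A = 1"
  shows "Gam d (trace_sq d A) (trace_sq d A) M \<le> 8"
proof -
  let ?m = "\<lambda>a k. Mt d A a k M"
  define R where "R = (\<lambda>a. \<Sum>k<d. (?m a k)\<^sup>2)"
  define C where "C = (\<lambda>a. \<Sum>k<d. (?m k a)\<^sup>2)"
  have "(Dv p (trace_sq d A) M)\<^sup>2 \<le> 8 * (R (fst p) * C (snd p) + R (snd p) * C (fst p))"
    if p: "p \<in> planes d" for p
  proof -
    obtain a b where ab: "p = (a, b)" by force
    have lt: "a < d" "b < d" "a \<noteq> b" using p by (auto simp: planes_def ab)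
    define X where "X = (\<Sum>k<d. ?m b k * ?m k a)"
    define Y where "Y = (\<Sum>k<d. ?m a k * ?m k b)"
    have "Dv p (trace_sq d A) M =
        (\<Sum>i<d. \<Sum>k<d. Dv p (Mt d A k i) M * ?m i k + Dv p (Mt d A i k) M * ?m k i)"
      unfolding trace_sq_def[abs_def] using p by (simp add: Dv_sum Dv_mult)
    also have "\<dots> = (\<Sum>i<d. \<Sum>k<d. Dv p (Mt d A k i) M * ?m i k) + (\<Sum>i<d. \<Sum>k<d. Dv p (Mt d A i k) M * ?m k i)"
      by (simp add: sum.distrib)
    also have "(\<Sum>i<d. \<Sum>k<d. Dv p (Mt d A k i) M * ?m i k) = (\<Sum>i<d. \<Sum>k<d. Dv p (Mt d A i k) M * ?m k i)"
      by (rule sum.swap)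
    also have "(\<Sum>i<d. \<Sum>k<d. Dv p (Mt d A i k) M * ?m k i) = Y - X"
    proof -
      have "(\<Sum>i<d. \<Sum>k<d. Dv p (Mt d A i k) M * ?m k i) =
          (\<Sum>i<d. (if i = a then - X else 0) + (if i = b then Y else 0))"
        using lt p by (intro sum.cong refl) (auto simp: Dv_Mt ab X_def Y_def sum_negf)
      then show ?thesis using lt by (simp add: sum.distrib)
    qed
    finally have D: "Dv p (trace_sq d A) M = 2 * (Y - X)" by simp
    have X: "X\<^sup>2 \<le> R b * C a"
      unfolding X_def R_def C_def by (rule Cauchy_Schwarz_ineq_sum)
    have Y: "Y\<^sup>2 \<le> R a * C b"
      unfolding Y_def R_def C_def by (rule Cauchy_Schwarz_ineq_sum)
    have "(Y - X)\<^sup>2 \<le> 2 * Y\<^sup>2 + 2 * X\<^sup>2"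
      using sum_squares_bound[of "-X" Y] zero_le_power2[of "X + Y"] by (simp add: power2_diff power2_sum mult.commute mult.left_commute)
    then have "4 * (Y - X)\<^sup>2 \<le> 8 * (R a * C b + R b * C a)"
      using X Y by argo
    moreover have "(2 * (Y - X))\<^sup>2 = 4 * (Y - X)\<^sup>2"
      by (simp only: power_mult_distrib) simp
    ultimately have "(2 * (Y - X))\<^sup>2 \<le> 8 * (R a * C b + R b * C a)"
      by (simp only:)
    then show ?thesis unfolding D by (simp only: ab fst_conv snd_conv)
  qed
  then have "Gam d (trace_sq d A) (trace_sq d A) M \<le>
      (\<Sum>p\<in>planes d. 8 * (R (fst p) * C (snd p) + R (snd p) * C (fst p)))"
    unfolding Gam_def power2_eq_square[symmetric] by (intro sum_mono)
  also have "\<dots> = 8 * (\<Sum>p\<in>planes d. R (fst p) * C (snd p) + R (snd p) * C (fst p))"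
    by (simp add: sum_distrib_left)
  also have "\<dots> \<le> 8 * ((\<Sum>a<d. R a) * (\<Sum>a<d. C a))"
    by (intro mult_left_mono sum_planes_sym_le) (auto simp: R_def C_def sum_nonneg)
  also have "(\<Sum>a<d. R a) = 1" using sum_Mt_sq[OF M, of A] A by (simp add: R_def)
  also have "(\<Sum>a<d. C a) = 1" unfolding C_def by (subst sum.swap) (use sum_Mt_sq[OF M, of A] A in simp)
  finally show ?thesis by simp
qed

section \<open>Multiplication by a linear form\<close>

locale unit_form = orth_haar +
  fixes A :: rmat
  assumes unit: "sqn d A = 1"
begin

abbreviation xm :: "(rmat \<Rightarrow> real) \<Rightarrow> rmat \<Rightarrow> real" where
  "xm h \<equiv> \<lambda>M. lin d A M * h M"

text \<open>By the Leibniz rule |grad (x h)|^2 = h^2 |grad x|^2 + <grad (x^2 h), grad h>, and the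
  last term integrates to <x^2 h, L h>.\<close>

lemma ip_Lap_xm:
  assumes "pol d h"
  shows "ip (xm h) (Lap d (xm h)) =
    E (\<lambda>M. (h M)\<^sup>2 * Gam d (lin d A) (lin d A) M) + ip (xm (Lap d h)) (xm h)"
proof -
  have "ip (xm (Lap d h)) (xm h) = ip (xm (xm h)) (Lap d h)"
    by (simp add: ip_def mult_ac)
  also have "\<dots> = E (Gam d (xm (xm h)) h)"
    using assms by (simp add: ip_Lap)
  finally have "ip (xm (Lap d h)) (xm h) = E (Gam d (xm (xm h)) h)" .
  moreover have "ip (xm h) (Lap d (xm h)) = E (Gam d (xm h) (xm h))"
    using assms by (simp add: ip_Lap)
  moreover have "Gam d (xm h) (xm h) = (\<lambda>M. (h M)\<^sup>2 * Gam d (lin d A) (lin d A) M + Gam d (xm (xm h)) h M)"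
  proof -
    have 1: "Gam d f (xm g) = (\<lambda>M. lin d A M * Gam d f g M + g M * Gam d f (lin d A) M)"
      if "pol d g" for f g using that by (simp add: Gam_mult)
    have 2: "Gam d (xm g) f = (\<lambda>M. lin d A M * Gam d g f M + g M * Gam d (lin d A) f M)"
      if "pol d g" for f g
      unfolding Gam_commute[of d "xm g" f] Gam_commute[of d g f] Gam_commute[of d "lin d A" f]
      by (rule 1[OF that])
    show ?thesis
      unfolding fun_eq_iff 1[OF assms] 2[OF assms] 2[OF pol_mult[OF pol_lin assms]]
        Gam_commute[of d h "lin d A"]
      by (simp add: power2_eq_square algebra_simps)
  qed
  ultimately show ?thesis using assms by simp
qed

text \<open>v is the projection of x h to degree at most t - 1, since \<open>Suc t\<close> is (t -
  1) + 2; the component u is always written as the difference. A relation is used because v is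
  unique only up to null functions.\<close>

definition split :: "nat \<Rightarrow> (rmat \<Rightarrow> real) \<Rightarrow> (rmat \<Rightarrow> real) \<Rightarrow> bool" where
  "split t h v \<longleftrightarrow> V t h \<and> dg d (Suc t) v \<and> perp (Suc t) (\<lambda>M. xm h M - v M)"

abbreviation up :: "(rmat \<Rightarrow> real) \<Rightarrow> (rmat \<Rightarrow> real) \<Rightarrow> real" where
  "up h v \<equiv> ip (\<lambda>M. xm h M - v M) (\<lambda>M. xm h M - v M)"

lemma split_ex:
  assumes "V t h"
  obtains v where "split t h v"
proof -
  have "pol d (xm h)" using V_pol[OF assms] by simp
  then obtain v where "dg d (Suc t) v" "perp (Suc t) (\<lambda>M. xm h M - v M)"
    by (rule projection_ex)
  then have "split t h v" using assms by (simp add: split_def)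
  then show thesis by (rule that)
qed

lemma split_pol:
  assumes "split t h v"
  shows "pol d h" "pol d v"
  using assms by (auto simp: split_def V_pol dg_pol)

lemma split_up_V:
  assumes "split t h v"
  shows "V (Suc t) (\<lambda>M. xm h M - v M)"
proof -
  have "dg d (Suc (Suc (Suc t))) (xm h)"
    using assms dg_lin_mult[of d "Suc (Suc t)" h A] by (simp add: split_def V_def)
  moreover have "dg d (Suc (Suc (Suc t))) v"
    using assms by (simp add: split_def dg_lower)
  ultimately show ?thesis
    using assms by (simp add: split_def V_def dg_diff)
qed

lemma split_down_zero:
  assumes "split 0 h v" "orthogonal_real d M"
  shows "v M = 0"
  using assms dg_less_2_zero[of d "Suc 0" v M] by (auto simp: split_def)

text \<open>Multiplication by x is self-adjoint: if w has degree at most s - 2, then x w has degree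
  at most s - 1 and is orthogonal to h. So x h lives only in the two degrees next to that of
  h.\<close>

lemma split_down_V:
  assumes "split (Suc s) h v"
  shows "V s v"
proof -
  note pols = split_pol[OF assms]
  have "ip v w = 0" if w: "dg d s w" for w
  proof -
    have "ip (\<lambda>M. xm h M - v M) w = 0"
      using assms dg_lower[OF w] by (auto simp: split_def perp_def)
    then have "ip v w = ip (xm h) w"
      using pols dg_pol[OF w] by (simp add: ip_linear)
    also have "\<dots> = ip h (xm w)" by (rule ip_mult_left)
    also have "\<dots> = 0"
      using assms dg_lin_mult[OF w] by (auto simp: split_def V_def perp_def)
    finally show ?thesis .
  qed
  then show ?thesis using assms by (simp add: V_def perp_def split_def)
qed

lemma split_norm:
  assumes "split t h v"
  shows "ip (xm h) (xm h) = up h v + ip v v" "ip (xm h) v = ip v v"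
proof -
  note pols = split_pol[OF assms]
  have "ip (\<lambda>M. xm h M - v M) v = 0"
    using assms by (auto simp: split_def perp_def)
  then show *: "ip (xm h) v = ip v v" using pols by (simp add: ip_linear)
  then show "ip (xm h) (xm h) = up h v + ip v v"
    using pols by (simp add: ip_linear ip_commute[of v "xm h"])
qed

text \<open>The leading eigenvalues of L on u, h, v are t + 1, t, t - 1 times d - 1. Subtracting the
  middle one leaves |u|^2 with sign + and |v|^2 with sign -; the right side collects N in the three
  degrees.\<close>

lemma split_balance:
  assumes s: "split t h v"
  shows "\<bar>(real d - 1) * (up h v - ip v v) - E (\<lambda>M. (h M)\<^sup>2 * Gam d (lin d A) (lin d A) M)\<bar>
    \<le> \<bar>ip (xm h) (xm (Nop d t h))\<bar> + real t * (real t + 1) * up h v + (real t)\<^sup>2 * ip v v"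
proof -
  note pols = split_pol[OF s]
  define u where "u = (\<lambda>M. xm h M - v M)"
  define m where "m = real d - 1"
  have u: "pol d u" using pols by (simp add: u_def)
  have Vu: "V (Suc t) u" using split_up_V[OF s] by (simp add: u_def)
  have xh: "xm h = (\<lambda>M. u M + v M)" by (simp add: u_def)
  have uLv: "ip u (Lap d v) = 0"
    using s dg_Lap[of d "Suc t" v] by (auto simp: split_def perp_def u_def)
  have vLu: "ip v (Lap d u) = 0"
    using Lap_symmetric[of v u] pols u uLv by (simp add: ip_commute[of "Lap d v" u])
  have "ip (xm h) (Lap d (xm h)) = ip u (Lap d u) + ip v (Lap d v)"
    unfolding xh using pols u uLv vLu by (simp add: Lap_add ip_linear)
  moreover have "ip u (Lap d u) = ip u (Nop d (Suc t) u) + (real t + 1) * m * ip u u"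
    unfolding Nop_def[abs_def] m_def using u by (simp add: ip_linear algebra_simps)
  moreover have "ip (xm (Lap d h)) (xm h) = ip (xm h) (xm (Nop d t h)) + real t * m * (ip u u + ip v v)"
  proof -
    have "xm (Nop d t h) = (\<lambda>M. xm (Lap d h) M - real t * m * xm h M)"
      by (auto simp: Nop_def m_def algebra_simps)
    then have "ip (xm h) (xm (Nop d t h)) = ip (xm h) (xm (Lap d h)) - real t * m * ip (xm h) (xm h)"
      using pols by (simp add: ip_linear)
    then show ?thesis using split_norm(1)[OF s] by (simp add: ip_commute[of "xm h" "xm (Lap d h)"] u_def)
  qed
  ultimately have eq: "m * (ip u u - ip v v) - E (\<lambda>M. (h M)\<^sup>2 * Gam d (lin d A) (lin d A) M) =
      ip (xm h) (xm (Nop d t h)) - ip u (Nop d (Suc t) u) - (ip v (Lap d v) - (real t - 1) * m * ip v v)"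
    using ip_Lap_xm[OF pols(1)] by (simp add: algebra_simps)
  have bu: "\<bar>ip u (Nop d (Suc t) u)\<bar> \<le> real t * (real t + 1) * ip u u"
    using abs_ip_Nop_le[OF Vu] by (simp add: mult.commute add.commute)
  \<comment> \<open>v has degree t - 1, so N is at most (t - 1) (t - 2) on it; for t = 0 it vanishes
    on O(d).\<close>
  have bv: "\<bar>ip v (Lap d v) - (real t - 1) * m * ip v v\<bar> \<le> (real t)\<^sup>2 * ip v v"
  proof (cases t)
    case 0
    have "ip v f = 0" if "pol d f" for f
      using ip_cong[of v "\<lambda>_. 0" f f] split_down_zero[of h v] s 0 pols that by simp
    then show ?thesis using pols by simp
  next
    case (Suc r)
    have Vv: "V r v" using split_down_V s Suc by simp
    have "ip v (Lap d v) - (real t - 1) * m * ip v v = ip v (Nop d r v)"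
      unfolding Nop_def[abs_def] m_def using pols by (simp add: ip_linear Suc)
    moreover have "real r * (real r - 1) * ip v v \<le> (real t)\<^sup>2 * ip v v"
      by (intro mult_right_mono ip_nonneg) (simp add: Suc power2_eq_square algebra_simps)
    ultimately show ?thesis using abs_ip_Nop_le[OF Vv] by linarith
  qed
  show ?thesis using eq bu bv unfolding m_def u_def[symmetric] by linarith
qed

lemma E_Gam_le:
  assumes "pol d h"
  shows "E (\<lambda>M. (h M)\<^sup>2 * Gam d (lin d A) (lin d A) M) \<le> 2 * ip h h"
proof -
  have "E (\<lambda>M. (h M)\<^sup>2 * Gam d (lin d A) (lin d A) M) \<le> E (\<lambda>M. 2 * (h M * h M))"
  proof (rule E_mono)
    fix M assume M: "orthogonal_real d M"
    have "(h M)\<^sup>2 * Gam d (lin d A) (lin d A) M \<le> (h M)\<^sup>2 * 2"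
      using abs_trace_sq_le[OF M, of A] by (intro mult_left_mono) (auto simp: Gam_lin[OF M] unit)
    then show "(h M)\<^sup>2 * Gam d (lin d A) (lin d A) M \<le> 2 * (h M * h M)"
      by (simp add: power2_eq_square)
  qed (use assms in auto)
  then show ?thesis by (simp add: ip_def)
qed

lemma ip_xm_le:
  assumes "pol d h"
  shows "ip (xm h) (xm h) \<le> real d * ip h h"
proof -
  have "ip (xm h) (xm h) \<le> E (\<lambda>M. real d * (h M * h M))"
    unfolding ip_def
  proof (rule E_mono)
    fix M assume "orthogonal_real d M"
    then show "xm h M * xm h M \<le> real d * (h M * h M)"
      using mult_right_mono[OF lin_sq_le, of d M "(h M)\<^sup>2" A] unit
      by (simp add: power2_eq_square mult_ac)
  qed (use assms in auto)
  then show ?thesis by (simp add: ip_def)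
qed

section \<open>Norms of the raising and lowering parts of x\<close>

definition up_bound :: "nat \<Rightarrow> real \<Rightarrow> bool" where
  "up_bound t k \<longleftrightarrow> (\<forall>h v. split t h v \<longrightarrow> up h v \<le> k * ip h h)"

definition down_bound :: "nat \<Rightarrow> real \<Rightarrow> bool" where
  "down_bound t k \<longleftrightarrow> (\<forall>h v. split t h v \<longrightarrow> ip v v \<le> k * ip h h)"

lemma down_bound_0: "down_bound 0 0"
  unfolding down_bound_def
proof (intro allI impI)
  fix h v assume s: "split 0 h v"
  have "ip v v = ip (\<lambda>_. 0) v"
    using split_down_zero[OF s] split_pol[OF s] by (intro ip_cong) auto
  then show "ip v v \<le> 0 * ip h h" by simp
qed

text \<open>Going down is adjoint to going up, so both have the same norm.\<close>

lemma down_bound_Suc: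
  assumes "up_bound t k" "0 \<le> k"
  shows "down_bound (Suc t) k"
  unfolding down_bound_def
proof (intro allI impI)
  fix h v assume s: "split (Suc t) h v"
  note pols = split_pol[OF s]
  obtain w where w: "split t v w" using split_down_V[OF s] by (rule split_ex)
  define u where "u = (\<lambda>M. xm v M - w M)"
  have polu: "pol d u" using split_pol[OF w] by (simp add: u_def)
  have "ip h w = 0"
    using s w by (auto simp: split_def V_def perp_def)
  moreover have "ip v v = ip h (xm v)"
    using split_norm(2)[OF s] ip_mult_left[of "lin d A" h v] by simp
  ultimately have eq: "ip v v = ip h u"
    using split_pol[OF w] pols by (simp add: u_def ip_linear)
  have "(ip v v)\<^sup>2 \<le> ip h h * ip u u"
    unfolding eq by (rule ip_Cauchy_Schwarz[OF pols(1) polu])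
  also have "\<dots> \<le> ip h h * (k * ip v v)"
    using assms(1) w by (intro mult_left_mono ip_nonneg) (auto simp: up_bound_def u_def)
  finally have "ip v v * ip v v \<le> ip v v * (k * ip h h)"
    by (simp add: power2_eq_square mult_ac)
  moreover have "0 \<le> k * ip h h" using assms(2) ip_nonneg by simp
  ultimately show "ip v v \<le> k * ip h h"
    using ip_nonneg[of v] by (cases "ip v v = 0") auto
qed

lemma ip_xm_le_bounds:
  assumes up: "up_bound t k" and down: "down_bound t k'" and h: "V t h"
  shows "ip (xm h) (xm h) \<le> (k + k') * ip h h"
proof -
  obtain v where v: "split t h v" using h by (rule split_ex)
  have "up h v \<le> k * ip h h" "ip v v \<le> k' * ip h h"
    using up down v by (auto simp: up_bound_def down_bound_def)
  then show ?thesis using split_norm(1)[OF v] by (simp add: distrib_right)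
qed

lemma ip_xm_Nop_le:
  assumes up: "up_bound t k" and down: "down_bound t k'" and nonneg: "0 \<le> k" "0 \<le> k'" and h: "V t h"
  shows "ip (xm (Nop d t h)) (xm (Nop d t h)) \<le> (k + k') * ((real t * (real t - 1))\<^sup>2 * ip h h)"
  using ip_xm_le_bounds[OF up down V_Nop[OF h]] mult_left_mono[OF Nop_norm_le[OF h], of "k + k'"] nonneg
  by linarith

text \<open>The balance read as an upper bound for u. The old bound k reappears only with the factor
  2 t^2 / (d - 1), so a poor k improves.\<close>

lemma up_bound_improve:
  assumes d: "d \<ge> 2" and up: "up_bound t k" and down: "down_bound t k'" and nonneg: "0 \<le> k" "0 \<le> k'"
  shows "up_bound t (k' + (2 + 2 * (real t)\<^sup>2 * (k + k')) / (real d - 1))"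
  unfolding up_bound_def
proof (intro allI impI)
  fix h v assume s: "split t h v"
  note pols = split_pol[OF s]
  define H where "H = ip h h"
  have H: "0 \<le> H" by (simp add: H_def ip_nonneg)
  have Vh: "V t h" using s by (simp add: split_def)
  have t: "0 \<le> real t * (real t - 1)" by (cases t) auto
  have U: "up h v \<le> k * H" and D: "ip v v \<le> k' * H"
    using up down s by (auto simp: up_bound_def down_bound_def H_def)
  have cross: "\<bar>ip (xm h) (xm (Nop d t h))\<bar> \<le> real t * (real t - 1) * ((k + k') * H)"
  proof (rule power2_le_iff_abs_le[THEN iffD1])
    have "(ip (xm h) (xm (Nop d t h)))\<^sup>2 \<le> ip (xm h) (xm h) * ip (xm (Nop d t h)) (xm (Nop d t h))"
      using pols by (intro ip_Cauchy_Schwarz) auto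
    also have "\<dots> \<le> ((k + k') * H) * ((k + k') * ((real t * (real t - 1))\<^sup>2 * H))"
      unfolding H_def using nonneg H
      by (intro mult_mono ip_xm_le_bounds[OF up down Vh] ip_xm_Nop_le[OF up down nonneg Vh] ip_nonneg) (auto simp: H_def)
    finally show "(ip (xm h) (xm (Nop d t h)))\<^sup>2 \<le> (real t * (real t - 1) * ((k + k') * H))\<^sup>2"
      by (simp add: power2_eq_square mult_ac)
    show "0 \<le> real t * (real t - 1) * ((k + k') * H)"
      using t nonneg H by (intro mult_nonneg_nonneg[OF t]) simp
  qed
  have "(real d - 1) * (up h v - ip v v) \<le>
      2 * H + real t * (real t - 1) * ((k + k') * H) + real t * (real t + 1) * (k * H) + (real t)\<^sup>2 * (k' * H)"
  proof -
    have "real t * (real t + 1) * up h v \<le> real t * (real t + 1) * (k * H)"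
      using U by (intro mult_left_mono) auto
    moreover have "(real t)\<^sup>2 * ip v v \<le> (real t)\<^sup>2 * (k' * H)"
      using D by (intro mult_left_mono) auto
    ultimately show ?thesis
      using split_balance[OF s] E_Gam_le[OF pols(1)] cross unfolding H_def by linarith
  qed
  also have "\<dots> \<le> (2 + 2 * (real t)\<^sup>2 * (k + k')) * H"
  proof -
    have "0 \<le> real t * (k' * H)" using nonneg H by simp
    then show ?thesis by (simp add: algebra_simps power2_eq_square)
  qed
  finally have "(real d - 1) * (up h v - ip v v) \<le> (2 + 2 * (real t)\<^sup>2 * (k + k')) * H" .
  then have "up h v - ip v v \<le> (2 + 2 * (real t)\<^sup>2 * (k + k')) * H / (real d - 1)"
    using d by (simp add: field_simps)
  then show "up h v \<le> (k' + (2 + 2 * (real t)\<^sup>2 * (k + k')) / (real d - 1)) * ip h h"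
    using D by (simp add: distrib_right flip: H_def)
qed

text \<open>The improvement is an affine map of slope below 1, so iterating it from the trivial bound \<open>d\<close>
  converges to its fixed point.\<close>

lemma up_bound_limit:
  assumes d: "d \<ge> 2" and down: "down_bound t (4 * real t / (real d - 1))"
    and t: "12 * (real t)^3 \<le> real d - 1"
  shows "up_bound t (4 * (real t + 1) / (real d - 1))"
proof -
  define m where "m = real d - 1"
  define g where "g = 4 * (real t + 1) / m"
  define b where "b = 2 * (real t)\<^sup>2 / m"
  have m: "m \<ge> 1" using d by (simp add: m_def)
  have t2: "(real t)\<^sup>2 \<le> (real t)^3"
    by (cases t) (auto simp: power2_eq_square power3_eq_cube)
  have tm: "12 * (real t)^3 \<le> m" using t by (simp add: m_def)
  have b: "0 \<le> b" "b < 1"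
    using m t2 tm by (auto simp: b_def field_simps)
  \<comment> \<open>16 t^3 + 8 t^2 <= 24 t^3 <= 2 (d - 1), so the error terms add at most 2 to the 2
    coming from |grad x|^2. Hence the increment 4 / (d - 1) per degree, and g is mapped to at most
    g.\<close>
  have fix_g: "4 * real t / m + (2 + 2 * (real t)\<^sup>2 * (g + 4 * real t / m)) / m \<le> g"
  proof -
    have "2 * (real t)\<^sup>2 * (g + 4 * real t / m) = (16 * (real t)^3 + 8 * (real t)\<^sup>2) / m"
      using m by (simp add: g_def field_simps power2_eq_square power3_eq_cube)
    also have "\<dots> \<le> 2" using m t2 tm by (simp add: field_simps)
    finally have "(2 + 2 * (real t)\<^sup>2 * (g + 4 * real t / m)) / m \<le> 4 / m"
      using m by (intro divide_right_mono) auto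
    then show ?thesis by (simp add: g_def add_divide_distrib algebra_simps)
  qed
  have iter: "up_bound t (g + b ^ n * real d)" for n
  proof (induction n)
    case 0
    show ?case
      unfolding up_bound_def
    proof (intro allI impI)
      fix h v assume s: "split t h v"
      have "up h v \<le> real d * ip h h"
        using ip_xm_le[OF split_pol(1)[OF s]] split_norm(1)[OF s] ip_nonneg[of v] by linarith
      also have "\<dots> \<le> (g + b ^ 0 * real d) * ip h h"
        using m by (intro mult_right_mono ip_nonneg) (simp add: g_def)
      finally show "up h v \<le> (g + b ^ 0 * real d) * ip h h" .
    qed
  next
    case (Suc n)
    have nonneg: "0 \<le> g + b ^ n * real d" "0 \<le> 4 * real t / m"
      using m b by (auto simp: g_def)
    have "up_bound t (4 * real t / m + (2 + 2 * (real t)\<^sup>2 * (g + b ^ n * real d + 4 * real t / m)) / m)"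
      using up_bound_improve[OF d Suc down] nonneg by (simp add: m_def)
    also have "4 * real t / m + (2 + 2 * (real t)\<^sup>2 * (g + b ^ n * real d + 4 * real t / m)) / m =
        4 * real t / m + (2 + 2 * (real t)\<^sup>2 * (g + 4 * real t / m)) / m + b ^ Suc n * real d"
      using m by (simp add: b_def field_simps)
    finally have "up_bound t \<dots>" .
    moreover have "\<dots> \<le> g + b ^ Suc n * real d" using fix_g by simp
    ultimately show ?case
      unfolding up_bound_def by (meson ip_nonneg mult_right_mono order_trans)
  qed
  show ?thesis
    unfolding up_bound_def
  proof (intro allI impI)
    fix h v assume s: "split t h v"
    have "(\<lambda>n. (g + b ^ n * real d) * ip h h) \<longlonglongrightarrow> (g + 0 * real d) * ip h h"
      using b by (intro tendsto_intros LIMSEQ_realpow_zero)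
    then show "up h v \<le> 4 * (real t + 1) / (real d - 1) * ip h h"
      using iter s by (intro LIMSEQ_le_const) (auto simp: up_bound_def g_def m_def)
  qed
qed

text \<open>Raising from degree t bounds lowering from t + 1 by adjointness, which is the input for
  the iteration in degree t + 1.\<close>

lemma up_down_bound:
  assumes d: "d \<ge> 2"
  shows "12 * (real t)^3 \<le> real d - 1 \<Longrightarrow>
    up_bound t (4 * (real t + 1) / (real d - 1)) \<and> down_bound t (4 * real t / (real d - 1))"
proof (induction t)
  case 0
  then show ?case using up_bound_limit[OF d, of 0] down_bound_0 by simp
next
  case (Suc t)
  have "(real t)^3 \<le> (real (Suc t))^3" by (intro power_mono) auto
  then have "12 * (real t)^3 \<le> real d - 1" using Suc.prems by linarith
  then have "up_bound t (4 * (real t + 1) / (real d - 1))" using Suc.IH by simp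
  then have "down_bound (Suc t) (4 * real (Suc t) / (real d - 1))"
    using down_bound_Suc d by (simp add: add.commute)
  then show ?case using up_bound_limit[OF d] Suc.prems by blast
qed

text \<open>By \<open>Lap_trace_sq\<close> the left side is <h^2, L tr> + 2 |h|^2 - 2 |x h|^2. By
  parts, <h^2, L tr> is 2 E h <grad tr, grad h>, which AM-GM with weight c bounds through |grad
  tr|^2 <= 8 and E |grad h|^2 = <h, L h> <= 2 t (d - 1) |h|^2.\<close>

lemma E_trace_sq_le:
  assumes d: "d \<ge> 2" and h: "V t h" and t: "t \<le> d" and c: "0 < c"
  shows "2 * (real d - 1) * E (\<lambda>M. (h M)\<^sup>2 * trace_sq d A M) \<le>
    (2 + 8 * c + 2 * real t * (real d - 1) / c) * ip h h"
proof -
  define m where "m = real d - 1"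
  note ph = V_pol[OF h]
  have "ip (\<lambda>M. (h M)\<^sup>2) (Lap d (trace_sq d A)) = E (Gam d (trace_sq d A) (\<lambda>M. (h M)\<^sup>2))"
    using ph by (simp add: ip_Lap Gam_commute[of d "\<lambda>M. (h M)\<^sup>2"])
  also have "Gam d (trace_sq d A) (\<lambda>M. (h M)\<^sup>2) = (\<lambda>M. 2 * h M * Gam d (trace_sq d A) h M)"
    using ph by (simp add: power2_eq_square Gam_mult mult.assoc)
  also have "E \<dots> \<le> E (\<lambda>M. 8 * c * (h M * h M) + Gam d h h M / c)"
  proof (rule E_mono)
    fix M assume M: "orthogonal_real d M"
    define G where "G = Gam d (trace_sq d A) h M"
    have "G\<^sup>2 \<le> Gam d (trace_sq d A) (trace_sq d A) M * Gam d h h M"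
      unfolding G_def by (rule Gam_Cauchy_Schwarz)
    also have "\<dots> \<le> 8 * Gam d h h M"
      using Gam_trace_sq_le[OF M unit] Gam_self_nonneg by (intro mult_right_mono)
    finally have G: "G\<^sup>2 / (8 * c) \<le> Gam d h h M / c"
      using c by (simp add: field_simps)
    have "0 \<le> (8 * c * h M - G)\<^sup>2 / (8 * c)" using c by simp
    also have "\<dots> = 8 * c * (h M * h M) - 2 * h M * G + G\<^sup>2 / (8 * c)"
      using c by (simp add: field_simps power2_eq_square)
    finally show "2 * h M * Gam d (trace_sq d A) h M \<le> 8 * c * (h M * h M) + Gam d h h M / c"
      using G unfolding G_def by linarith
  qed (use ph in auto)
  also have "\<dots> = 8 * c * ip h h + ip h (Lap d h) / c"
    using ph by (simp add: ip_def[of h h] ip_Lap)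
  also have "ip h (Lap d h) \<le> 2 * real t * m * ip h h"
  proof -
    have "ip h (Lap d h) = ip h (Nop d t h) + real t * m * ip h h"
      unfolding Nop_def[abs_def] m_def using ph by (simp add: ip_linear)
    moreover have "real t * (real t - 1) * ip h h \<le> real t * m * ip h h"
      using t by (intro mult_right_mono mult_left_mono ip_nonneg) (auto simp: m_def)
    ultimately show ?thesis using abs_ip_Nop_le[OF h] by linarith
  qed
  finally have "ip (\<lambda>M. (h M)\<^sup>2) (Lap d (trace_sq d A)) \<le> 8 * c * ip h h + 2 * real t * m * ip h h / c"
    using c by (simp add: divide_right_mono)
  moreover have "ip (\<lambda>M. (h M)\<^sup>2) (Lap d (trace_sq d A)) =
      2 * m * E (\<lambda>M. (h M)\<^sup>2 * trace_sq d A M) + 2 * ip (xm h) (xm h) - 2 * ip h h"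
  proof -
    have "ip (\<lambda>M. (h M)\<^sup>2) (Lap d (trace_sq d A)) =
        E (\<lambda>M. 2 * m * ((h M)\<^sup>2 * trace_sq d A M) + 2 * (xm h M * xm h M) - 2 * (h M * h M))"
      unfolding ip_def using ph
      by (intro E_cong) (auto simp: Lap_trace_sq unit m_def power2_eq_square algebra_simps)
    then show ?thesis using ph by (simp add: ip_def)
  qed
  ultimately have "2 * m * E (\<lambda>M. (h M)\<^sup>2 * trace_sq d A M) \<le>
      2 * ip h h + 8 * c * ip h h + 2 * real t * m * ip h h / c"
    using ip_nonneg[of "xm h"] by linarith
  then show ?thesis by (simp add: m_def algebra_simps)
qed

lemma up_lower_bound:
  assumes s: "split t h v" and d: "d \<ge> 2" and tT: "Suc t \<le> T" and T: "12 * (real T)^3 \<le> real d - 1"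
  shows "(1 - (5 * sqrt (real T / (real d - 1)) + 6 * ((real T)\<^sup>2 * sqrt (real T) / (real d - 1)))) / real d * ip h h
    \<le> up h v"
proof -
  define m where "m = real d - 1"
  define R where "R = (real T)\<^sup>2 * sqrt (real T)"
  define \<eta> where "\<eta> = 5 * sqrt (real T / m)"
  define H where "H = ip h h"
  define U where "U = up h v"
  define D where "D = ip v v"
  note pols = split_pol[OF s]
  have Vh: "V t h" using s by (simp add: split_def)
  have H: "0 \<le> H" and U: "0 \<le> U" and D: "0 \<le> D" by (simp_all add: H_def U_def D_def ip_nonneg)
  have T1: "real T \<ge> 1" using tT by simp
  have m: "m \<ge> 12" using T one_le_power[OF T1, of 3] unfolding m_def by linarith
  have R2: "R\<^sup>2 = (real T)^5" using T1 by (simp add: R_def power_mult_distrib flip: power_mult power_Suc2)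
  have RT2: "(real T)\<^sup>2 \<le> R" using T1 mult_left_mono[of 1 "sqrt (real T)" "(real T)\<^sup>2"] by (simp add: R_def)
  have RT3: "R \<le> (real T)^3"
  proof -
    have "sqrt (real T) \<le> real T" using T1 real_sqrt_le_mono[of "real T" "(real T)\<^sup>2"]
      by (simp add: power2_eq_square)
    then show ?thesis using mult_left_mono[of "sqrt (real T)" "real T" "(real T)\<^sup>2"]
      by (simp add: R_def power2_eq_square power3_eq_cube)
  qed
  have R: "1 \<le> R" "12 * R \<le> m"
    using RT2 RT3 T one_le_power[OF T1, of 2] unfolding m_def by linarith+
  have td: "t \<le> d"
  proof -
    have "real T \<le> (real T)^3" using T1 power_increasing[of 1 3 "real T"] by simp
    moreover have "real t \<le> real T" using tT by simp
    ultimately have "real t \<le> real d" using T T1 by linarith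
    then show ?thesis by simp
  qed
  have t3: "12 * (real t)^3 \<le> real d - 1"
  proof -
    have "(real t)^3 \<le> (real T)^3" using tT by (intro power_mono) auto
    then show ?thesis using T by linarith
  qed
  have Gam: "E (\<lambda>M. (h M)\<^sup>2 * Gam d (lin d A) (lin d A) M) \<ge> (1 - \<eta>) * H"
  proof -
    have Tm: "1 \<le> real T * m" using T1 m mult_mono[of 1 "real T" 1 m] by simp
    \<comment> \<open>Balances 8 c against 2 T m / c: both become 4 sqrt (T m). With the summand 2
      this gives 10 sqrt (T m), hence the 5 in \<eta>.\<close>
    define c where "c = sqrt (real T * m) / 2"
    have c: "0 < c" using Tm by (simp add: c_def)
    have sq: "sqrt (real T * m) * sqrt (real T * m) = real T * m" using Tm by simp
    have "2 * real t * m / c \<le> 2 * real T * m / c"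
      using tT m c by (intro divide_right_mono mult_right_mono mult_left_mono) auto
    also have "\<dots> = 4 * sqrt (real T * m)"
    proof -
      define q where "q = sqrt (real T * m)"
      have q: "real T * m = q * q" "c = q / 2"
        unfolding q_def c_def by (rule sq[symmetric]) (rule refl)
      have "2 * real T * m / c = 2 * (q * q) / (q / 2)"
        unfolding q(2) by (simp only: mult.assoc q(1))
      also have "\<dots> = 4 * q" using c q(2) by simp
      finally show ?thesis by (simp only: q_def)
    qed
    finally have "2 + 8 * c + 2 * real t * m / c \<le> 2 + 8 * sqrt (real T * m)"
      by (simp add: c_def)
    also have "\<dots> \<le> 10 * sqrt (real T * m)" using Tm by simp
    also have "\<dots> = 2 * m * \<eta>"
    proof -
      have "m * sqrt (real T / m) = sqrt (real T * m)"
      proof -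
        have "real T * m = m\<^sup>2 * (real T / m)" using m by (simp add: power2_eq_square)
        then show ?thesis using m by (simp only: real_sqrt_mult real_sqrt_abs)
      qed
      then show ?thesis by (simp add: \<eta>_def)
    qed
    finally have "(2 + 8 * c + 2 * real t * m / c) * H \<le> 2 * m * \<eta> * H"
      using H by (intro mult_right_mono)
    then have "2 * m * E (\<lambda>M. (h M)\<^sup>2 * trace_sq d A M) \<le> 2 * m * (\<eta> * H)"
      using E_trace_sq_le[OF d Vh td c] by (simp add: m_def H_def mult.assoc)
    then have "E (\<lambda>M. (h M)\<^sup>2 * trace_sq d A M) \<le> \<eta> * H"
      using m by simp
    moreover have "E (\<lambda>M. (h M)\<^sup>2 * Gam d (lin d A) (lin d A) M) = H - E (\<lambda>M. (h M)\<^sup>2 * trace_sq d A M)"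
    proof -
      have "E (\<lambda>M. (h M)\<^sup>2 * Gam d (lin d A) (lin d A) M) = E (\<lambda>M. h M * h M - (h M)\<^sup>2 * trace_sq d A M)"
        using pols by (intro E_cong) (auto simp: Gam_lin unit power2_eq_square algebra_simps)
      then show ?thesis using pols by (simp add: H_def ip_def)
    qed
    ultimately show ?thesis by (simp add: left_diff_distrib)
  qed
  have cross: "\<bar>ip (xm h) (xm (Nop d t h))\<bar> \<le> R / 2 * (U + D) + 4 * R / m * H"
  proof -
    have kk: "up_bound t (4 * (real t + 1) / m)" "down_bound t (4 * real t / m)"
      using up_down_bound[OF d t3] by (simp_all add: m_def)
    have t0: "0 \<le> real t * (real t - 1)" by (cases t) auto
    have t2: "(real t * (real t - 1))\<^sup>2 \<le> ((real T)\<^sup>2)\<^sup>2"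
    proof (intro power_mono t0)
      have "real t * (real t - 1) \<le> real t * real t" by (intro mult_left_mono) auto
      also have "\<dots> \<le> real T * real T" using tT by (intro mult_mono) auto
      finally show "real t * (real t - 1) \<le> (real T)\<^sup>2" by (simp add: power2_eq_square)
    qed
    have "4 * (real t + 1) / m + 4 * real t / m \<le> 8 * real T / m"
    proof -
      have "real (Suc t) \<le> real T" using tT by (simp only: of_nat_le_iff)
      then show ?thesis
        unfolding add_divide_distrib[symmetric] using m by (intro divide_right_mono) auto
    qed
    then have "(4 * (real t + 1) / m + 4 * real t / m) * ((real t * (real t - 1))\<^sup>2 * H)
        \<le> (8 * real T / m) * (((real T)\<^sup>2)\<^sup>2 * H)"
      using t2 m H by (intro mult_mono mult_right_mono) auto
    also have "\<dots> = 8 * R\<^sup>2 / m * H"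
    proof -
      have "real T * ((real T)\<^sup>2)\<^sup>2 = R\<^sup>2" unfolding R2 by (simp add: eval_nat_numeral)
      then show ?thesis by (simp flip: \<open>real T * ((real T)\<^sup>2)\<^sup>2 = R\<^sup>2\<close>)
    qed
    finally have N: "ip (xm (Nop d t h)) (xm (Nop d t h)) \<le> 8 * R\<^sup>2 / m * H"
      using ip_xm_Nop_le[OF kk _ _ Vh] m unfolding H_def by force
    \<comment> \<open>With weight R the second term becomes of order R / m, while R |x h|^2 only
      perturbs the coefficients of U and D.\<close>
    have "2 * \<bar>ip (xm h) (xm (Nop d t h))\<bar> \<le> R * ip (xm h) (xm h) + ip (xm (Nop d t h)) (xm (Nop d t h)) / R"
      using pols R by (intro ip_AM_GM) auto
    also have "\<dots> \<le> R * (U + D) + (8 * R\<^sup>2 / m * H) / R"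
      using split_norm(1)[OF s] N R by (intro add_mono divide_right_mono) (auto simp: U_def D_def)
    also have "(8 * R\<^sup>2 / m * H) / R = 8 * R / m * H"
      using R by (simp add: power2_eq_square)
    also have "R * (U + D) + 8 * R / m * H = 2 * (R / 2 * (U + D) + 4 * R / m * H)"
      by (simp add: algebra_simps)
    finally show ?thesis by (simp only: mult_le_cancel_left_pos zero_less_numeral)
  qed
  have tU: "real t * (real t + 1) * U \<le> R * U"
  proof (intro mult_right_mono U)
    have "real t * (real t + 1) \<le> real T * real T" using tT by (intro mult_mono) auto
    then show "real t * (real t + 1) \<le> R" using RT2 by (simp add: power2_eq_square)
  qed
  have tD: "(real t)\<^sup>2 * D \<le> R * D"
  proof (intro mult_right_mono D)
    have "(real t)\<^sup>2 \<le> (real T)\<^sup>2" using tT by (intro power_mono) auto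
    then show "(real t)\<^sup>2 \<le> R" using RT2 by linarith
  qed
  have "(1 - \<eta> - 4 * R / m) * H \<le> m * (U - D) + R / 2 * (U + D) + R * U + R * D"
  proof -
    have "(1 - \<eta> - 4 * R / m) * H = (1 - \<eta>) * H - 4 * R / m * H"
      by (rule left_diff_distrib)
    then show ?thesis
      using split_balance[OF s, folded m_def U_def D_def] Gam cross tU tD by argo
  qed
  also have "\<dots> = (m + 3/2 * R) * U - (m - 3/2 * R) * D"
    by (simp add: field_simps)
  \<comment> \<open>3/2 R is R / 2 from the cross term plus R from N on u and v. As m >= 12 R, the
    coefficient of D is negative and D can be discarded.\<close>
  also have "\<dots> \<le> (m + 3/2 * R) * U" using R D by simp
  finally have main: "(1 - \<eta> - 4 * R / m) * H \<le> (m + 3/2 * R) * U" .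
  have "(1 - (\<eta> + 6 * (R / m))) / real d * H \<le> U"
  proof (cases "1 - (\<eta> + 6 * (R / m)) \<le> 0")
    case True
    then have "(1 - (\<eta> + 6 * (R / m))) / real d * H \<le> 0"
      using H by (intro mult_nonpos_nonneg divide_nonpos_nonneg) auto
    then show ?thesis using U by linarith
  next
    case False
    define a where "a = \<eta> + 4 * (R / m)"
    define r where "r = R / m"
    have \<eta>: "0 \<le> \<eta>" using m by (simp add: \<eta>_def)
    have r: "0 \<le> r" "R = m * r" using R m by (simp_all add: r_def)
    have a: "0 \<le> a" "a + 2 * r < 1"
      unfolding a_def r_def[symmetric] using False[folded r_def] \<eta> r(1) by linarith+
    \<comment> \<open>Dividing by m + 3/2 R instead of m costs at most 2 R / m; with the 4 R / m
      inside a, this is the constant 6.\<close>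
    have "(1 - a - 2 * r) * (m + 3/2 * R) \<le> (1 - a) * m"
    proof -
      have "(1 - a - 2 * r) * (1 + 3/2 * r) \<le> 1 - a"
      proof -
        have "0 \<le> a * r" "0 \<le> r * r" using a r by auto
        then show ?thesis using r by (simp add: algebra_simps)
      qed
      from mult_right_mono[OF this, of m] show ?thesis using m by (simp add: r(2) algebra_simps)
    qed
    also have "\<dots> \<le> (1 - a) * real d" using a r by (intro mult_left_mono) (auto simp: m_def)
    finally have "(1 - a - 2 * r) * (m + 3/2 * R) \<le> (1 - a) * real d" .
    then have "(1 - a - 2 * r) / real d \<le> (1 - a) / (m + 3/2 * R)"
    proof -
      assume "(1 - a - 2 * r) * (m + 3/2 * R) \<le> (1 - a) * real d"
      moreover have "0 < m + 3/2 * R" "0 < real d" using m R d by auto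
      ultimately show ?thesis by (simp only: pos_le_divide_eq pos_divide_le_eq times_divide_eq_left)
    qed
    then have "(1 - a - 2 * r) / real d * H \<le> (1 - a) / (m + 3/2 * R) * H"
      using H by (rule mult_right_mono)
    also have "\<dots> \<le> U"
    proof -
      have "(1 - a) * H \<le> U * (m + 3/2 * R)"
        using main by (simp add: a_def diff_diff_eq mult.commute)
      moreover have "0 < m + 3/2 * R" using m R by auto
      ultimately show ?thesis by (simp only: pos_divide_le_eq times_divide_eq_left)
    qed
    also have "1 - a - 2 * r = 1 - (\<eta> + 6 * (R / m))" by (simp add: a_def r_def)
    finally show ?thesis .
  qed
  then show ?thesis by (simp add: \<eta>_def R_def m_def H_def U_def)
qed

end

section \<open>Products of squares of linear forms\<close>

text \<open>Relative loss per query, uniform over the degrees below T: the first summand comes from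
  the average of tr((O A^t)^2), the second from N.\<close>

definition loss :: "nat \<Rightarrow> nat \<Rightarrow> real" where
  "loss d T = 5 * sqrt (real T / (real d - 1)) + 6 * ((real T)\<^sup>2 * sqrt (real T) / (real d - 1))"

lemma lin_scale: "lin d (\<lambda>i j. c * A i j) M = c * lin d A M"
  by (simp add: lin_def sum_distrib_left mult.assoc)

lemma sqn_scale: "sqn d (\<lambda>i j. c * A i j) = c\<^sup>2 * sqn d A"
  by (simp add: sqn_def sum_distrib_left power_mult_distrib)

lemma sqn_nonneg: "0 \<le> sqn d A"
  by (simp add: sqn_def sum_nonneg)

lemma pol_prod_list [intro, simp]:
  "(\<And>x. x \<in> set xs =simp=> pol d (f x)) \<Longrightarrow> pol d (\<lambda>M. \<Prod>x\<leftarrow>xs. f x M)"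
  unfolding simp_implies_def by (induction xs) auto

lemma pol_sum_list [intro, simp]:
  "(\<And>x. x \<in> set xs =simp=> pol d (f x)) \<Longrightarrow> pol d (\<lambda>M. \<Sum>x\<leftarrow>xs. f x M)"
  unfolding simp_implies_def by (induction xs) auto

lemma prod_list_nonneg_real: "(\<And>x. x \<in> set xs \<Longrightarrow> (0::real) \<le> f x) \<Longrightarrow> 0 \<le> (\<Prod>x\<leftarrow>xs. f x)"
  by (induction xs) auto

lemma prod_list_mult_distrib:
  fixes f g :: "'a \<Rightarrow> real"
  shows "(\<Prod>x\<leftarrow>xs. f x * g x) = (\<Prod>x\<leftarrow>xs. f x) * (\<Prod>x\<leftarrow>xs. g x)"
  by (induction xs) (auto simp: mult_ac)

context orth_haar
begin

text \<open>The remainder of lower degree, multiplied by a further form, together with v again has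
  too low a degree to touch the top component; so only h needs to be followed.\<close>

lemma top_component_ex:
  assumes d: "d \<ge> 2" and T: "12 * (real T)^3 \<le> real d - 1" and loss: "loss d T \<le> 1"
  shows "(\<And>A. A \<in> set As \<Longrightarrow> sqn d A = 1) \<Longrightarrow> length As \<le> T \<Longrightarrow>
    \<exists>h. V (length As) h \<and> dg d (length As) (\<lambda>M. (\<Prod>A\<leftarrow>As. lin d A M) - h M) \<and>
        ((1 - loss d T) / real d) ^ length As \<le> ip h h"
proof (induction As)
  case Nil
  have "perp 0 (\<lambda>_. 1)"
    unfolding perp_def
  proof (intro allI impI)
    fix w assume w: "dg d 0 w"
    have "ip (\<lambda>_. 1) w = ip (\<lambda>_. 1) (\<lambda>_. 0)"
      using dg_less_2_zero[OF w] dg_pol[OF w] by (intro ip_cong) auto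
    then show "ip (\<lambda>_. 1) w = 0" by simp
  qed
  then show ?case
    using dg_const[of d 1] by (intro exI[of _ "\<lambda>_. 1"]) (simp add: V_def dg_zero ip_def prob_space numeral_2_eq_2)
next
  case (Cons A As)
  then obtain h where h: "V (length As) h" "dg d (length As) (\<lambda>M. (\<Prod>A\<leftarrow>As. lin d A M) - h M)"
    "((1 - loss d T) / real d) ^ length As \<le> ip h h"
    by auto
  interpret unit_form d \<mu> A
    by unfold_locales (use Cons.prems in simp)
  obtain v where v: "split (length As) h v" using h(1) by (rule split_ex)
  define u where "u = (\<lambda>M. xm h M - v M)"
  have "V (length (A # As)) u" using split_up_V[OF v] by (simp add: u_def)
  moreover have "dg d (length (A # As)) (\<lambda>M. (\<Prod>A\<leftarrow>A # As. lin d A M) - u M)"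
  proof -
    have "dg d (Suc (length As)) (\<lambda>M. lin d A M * ((\<Prod>A\<leftarrow>As. lin d A M) - h M) + v M)"
      using v h(2) by (intro dg_add dg_lin_mult) (simp_all add: split_def)
    then show ?thesis by (simp add: u_def algebra_simps)
  qed
  moreover have "((1 - loss d T) / real d) ^ length (A # As) \<le> ip u u"
  proof -
    have "((1 - loss d T) / real d) ^ length (A # As) \<le> (1 - loss d T) / real d * ip h h"
      using h(3) loss mult_left_mono[OF h(3), of "(1 - loss d T) / real d"] by simp
    also have "\<dots> \<le> ip u u"
      unfolding u_def using up_lower_bound[OF v d _ T] Cons.prems(2) by (simp add: loss_def)
    finally show ?thesis .
  qed
  ultimately show ?case by blast
qed

text \<open>Pythagoras: the remainder has lower degree than h and is orthogonal to it.\<close>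

lemma E_prod_lin_sq_unit:
  assumes d: "d \<ge> 2" and T: "12 * (real T)^3 \<le> real d - 1" and loss: "loss d T \<le> 1"
    and As: "\<And>A. A \<in> set As \<Longrightarrow> sqn d A = 1" "length As \<le> T"
  shows "((1 - loss d T) / real d) ^ length As \<le> E (\<lambda>M. \<Prod>A\<leftarrow>As. (lin d A M)\<^sup>2)"
proof -
  define f where "f = (\<lambda>M. \<Prod>A\<leftarrow>As. lin d A M)"
  have f: "pol d f" by (simp add: f_def)
  obtain h where h: "V (length As) h" "dg d (length As) (\<lambda>M. f M - h M)"
    "((1 - loss d T) / real d) ^ length As \<le> ip h h"
    using top_component_ex[OF d T loss As] unfolding f_def by blast
  have "ip h (\<lambda>M. f M - h M) = 0" using h by (auto simp: V_def perp_def)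
  then have "ip f f = ip h h + ip (\<lambda>M. f M - h M) (\<lambda>M. f M - h M)"
    using f V_pol[OF h(1)] by (simp add: ip_linear ip_commute[of f h])
  then have "ip h h \<le> ip f f" using ip_nonneg[of "\<lambda>M. f M - h M"] by linarith
  also have "ip f f = E (\<lambda>M. \<Prod>A\<leftarrow>As. (lin d A M)\<^sup>2)"
    by (simp add: ip_def f_def power2_eq_square prod_list_mult_distrib)
  finally show ?thesis using h(3) by linarith
qed

text \<open>Both sides are homogeneous in each form, so nonzero forms can be normalised; a zero form
  makes the left side 0. Bernoulli's inequality turns (1 - loss)^T into 1 - T loss.\<close>

lemma E_prod_lin_sq:
  assumes d: "d \<ge> 2" and T: "12 * (real T)^3 \<le> real d - 1" and loss: "loss d T \<le> 1"
    and len: "length As = T"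
  shows "(1 - real T * loss d T) * (\<Prod>A\<leftarrow>As. sqn d A / real d) \<le> E (\<lambda>M. \<Prod>A\<leftarrow>As. (lin d A M)\<^sup>2)"
proof (cases "\<exists>A\<in>set As. sqn d A = 0")
  case True
  then have "(\<Prod>A\<leftarrow>As. sqn d A / real d) = 0" by (force simp: prod_list_zero_iff)
  moreover have "0 \<le> E (\<lambda>M. \<Prod>A\<leftarrow>As. (lin d A M)\<^sup>2)"
    by (intro Bochner_Integration.integral_nonneg prod_list_nonneg_real) simp
  ultimately show ?thesis by simp
next
  case False
  then have pos: "sqn d A > 0" if "A \<in> set As" for A using that sqn_nonneg[of d A] by force
  define n where "n = (\<lambda>A. (\<lambda>i j. 1 / sqrt (sqn d A) * A i j) :: rmat)"
  have unit: "sqn d (n A) = 1" if "A \<in> set As" for A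
    unfolding n_def sqn_scale using pos[OF that] by (simp add: power_divide)
  have lin: "(lin d A M)\<^sup>2 = sqn d A * (lin d (n A) M)\<^sup>2" if "A \<in> set As" for A M
    unfolding n_def lin_scale using pos[OF that] by (simp add: power_mult_distrib power_divide)
  have P: "0 \<le> (\<Prod>A\<leftarrow>As. sqn d A)" by (intro prod_list_nonneg_real sqn_nonneg)
  have "(1 - real T * loss d T) * (\<Prod>A\<leftarrow>As. sqn d A / real d)
      = (\<Prod>A\<leftarrow>As. sqn d A) * ((1 + real T * - loss d T) / real d ^ length As)"
    unfolding divide_inverse prod_list_mult_distrib by (simp add: map_replicate_const power_inverse)
  also have "\<dots> \<le> (\<Prod>A\<leftarrow>As. sqn d A) * ((1 - loss d T) ^ T / real d ^ length As)"
    using Bernoulli_inequality[of "- loss d T" T] loss P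
    by (intro mult_left_mono divide_right_mono) auto
  also have "\<dots> = (\<Prod>A\<leftarrow>As. sqn d A) * ((1 - loss d T) / real d) ^ length (map n As)"
    by (simp add: power_divide len)
  also have "\<dots> \<le> (\<Prod>A\<leftarrow>As. sqn d A) * E (\<lambda>M. \<Prod>A\<leftarrow>map n As. (lin d A M)\<^sup>2)"
    using unit len by (intro mult_left_mono E_prod_lin_sq_unit[OF d T loss] P) auto
  also have "\<dots> = E (\<lambda>M. (\<Prod>A\<leftarrow>As. sqn d A) * (\<Prod>A\<leftarrow>map n As. (lin d A M)\<^sup>2))"
    by simp
  also have "(\<lambda>M. (\<Prod>A\<leftarrow>As. sqn d A) * (\<Prod>A\<leftarrow>map n As. (lin d A M)\<^sup>2)) = (\<lambda>M. \<Prod>A\<leftarrow>As. (lin d A M)\<^sup>2)"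
    by (simp add: fun_eq_iff prod_list_mult_distrib[symmetric] comp_def lin cong: map_cong)
  finally show ?thesis .
qed

end

section \<open>Outcome probabilities as sums of squares\<close>

definition qf :: "nat \<Rightarrow> cmatf \<Rightarrow> (nat \<Rightarrow> complex) \<Rightarrow> complex" where
  "qf D F v = (\<Sum>i<D. \<Sum>j<D. cnj (v i) * F i j * v j)"

lemma psd_qf: "psd D F \<longleftrightarrow> (\<forall>v. Im (qf D F v) = 0 \<and> 0 \<le> Re (qf D F v))"
  by (simp add: psd_def qf_def)

lemma qf_two:
  assumes "i < D" "j < D" "i \<noteq> j"
  shows "qf D F (\<lambda>k. if k = i then x else if k = j then y else 0) =
    cnj x * F i i * x + cnj x * F i j * y + cnj y * F j i * x + cnj y * F j j * y"
proof -
  let ?v = "\<lambda>k. if k = i then x else if k = j then y else 0"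
  have sum: "(\<Sum>k<D. f k) = f i + f j" if "\<And>k. k \<noteq> i \<Longrightarrow> k \<noteq> j \<Longrightarrow> f k = 0" for f :: "nat \<Rightarrow> complex"
  proof -
    have "(\<Sum>k<D. f k) = (\<Sum>k\<in>{i, j}. f k)"
      using assms that by (intro sum.mono_neutral_right) auto
    then show ?thesis using assms by simp
  qed
  have "qf D F ?v = (\<Sum>k<D. cnj (?v k) * F k i * x + cnj (?v k) * F k j * y)"
    unfolding qf_def using assms by (intro sum.cong refl) (subst sum, auto)
  also have "\<dots> = cnj x * F i i * x + cnj x * F i j * y + (cnj y * F j i * x + cnj y * F j j * y)"
    using assms by (subst sum) auto
  finally show ?thesis by simp
qed

text \<open>\<open>psd\<close> asks only for real nonnegative values of the quadratic form, so
  symmetry is recovered by polarization at e_i + e_j and e_i + \<i> e_j.\<close>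

lemma psd_hermitian:
  assumes psd: "psd D F" and ij: "i < D" "j < D"
  shows "F j i = cnj (F i j)"
proof -
  have diag: "Im (F k k) = 0" if "k < D" for k
  proof -
    have "qf D F (\<lambda>l. if l = k then 1 else 0) = (\<Sum>i<D. if i = k then F k k else 0)"
      unfolding qf_def
    proof (intro sum.cong refl)
      fix i
      have "(\<Sum>j<D. cnj (if i = k then 1 else 0) * F i j * (if j = k then 1 else 0)) =
          (\<Sum>j<D. if j = k then (if i = k then F k k else 0) else 0)"
        by (intro sum.cong) auto
      then show "(\<Sum>j<D. cnj (if i = k then 1 else 0) * F i j * (if j = k then 1 else 0)) = (if i = k then F k k else 0)"
        using that by simp
    qed
    then have "qf D F (\<lambda>l. if l = k then 1 else 0) = F k k" using that by simp
    then show ?thesis using psd unfolding psd_qf by metis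
  qed
  show ?thesis
  proof (cases "i = j")
    case True
    then show ?thesis using diag[OF ij(1)] by (simp add: complex_eq_iff)
  next
    case False
    have "Im (qf D F (\<lambda>k. if k = i then 1 else if k = j then 1 else 0)) = 0"
      "Im (qf D F (\<lambda>k. if k = i then 1 else if k = j then \<i> else 0)) = 0"
      using psd by (simp_all add: psd_qf)
    then show ?thesis
      unfolding qf_two[OF ij False] using diag ij by (simp add: complex_eq_iff)
  qed
qed

lemma qf_Suc:
  assumes psd: "psd (Suc D) F"
  shows "qf (Suc D) F v = qf D F v + cnj (\<Sum>j<D. F D j * v j) * v D
    + cnj (v D) * (\<Sum>j<D. F D j * v j) + cnj (v D) * F D D * v D"
proof -
  have "cnj (\<Sum>j<D. F D j * v j) = (\<Sum>i<D. cnj (v i) * F i D)"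
    using psd_hermitian[OF psd, of D] by (simp add: mult.commute)
  then show ?thesis
    by (simp add: qf_def sum.distrib sum_distrib_left sum_distrib_right mult_ac)
qed

lemma psd_zero_diag:
  assumes psd: "psd (Suc D) F" and zero: "F D D = 0" and j: "j < D"
  shows "F D j = 0"
proof (rule ccontr)
  assume nz: "F D j \<noteq> 0"
  define c where "c = (cmod (F D j))\<^sup>2"
  have c: "c > 0" using nz by (simp add: c_def)
  \<comment> \<open>Chosen so that the form would have real part -1 at e_j + y e_D.\<close>
  define s where "s = (Re (F j j) + 1) / (2 * c)"
  define y where "y = - complex_of_real s * F D j"
  have cc: "cnj (F D j) * F D j = of_real c"
    by (simp add: c_def complex_norm_square[symmetric] mult.commute)
  have "0 \<le> Re (qf (Suc D) F (\<lambda>k. if k = j then 1 else if k = D then y else 0))"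
    using psd by (simp add: psd_qf)
  also have "qf (Suc D) F (\<lambda>k. if k = j then 1 else if k = D then y else 0) =
      F j j + F j D * y + cnj y * F D j"
    using j zero by (subst qf_two) auto
  also have "\<dots> = F j j - of_real (2 * s * c)"
    using psd_hermitian[OF psd, of D j] j cc by (simp add: y_def algebra_simps)
  finally have "0 \<le> Re (F j j) - 2 * s * c" by simp
  then show False using c by (simp add: s_def)
qed

lemma psd_sum_rank_one:
  "psd D F \<Longrightarrow> \<exists>xs :: (nat \<Rightarrow> complex) list. \<forall>i<D. \<forall>j<D. F i j = (\<Sum>x\<leftarrow>xs. x i * cnj (x j))"
proof (induction D arbitrary: F)
  case 0
  then show ?case by simp
next
  case (Suc D)
  note herm = psd_hermitian[OF Suc.prems]
  define a where "a = Re (F D D)"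
  have Faa: "F D D = of_real a" using herm[of D D] by (simp add: a_def complex_eq_iff)
  have a0: "a \<ge> 0"
  proof -
    have "qf (Suc D) F (\<lambda>k. if k = D then 1 else 0) = F D D"
      by (subst qf_Suc[OF Suc.prems]) (simp add: qf_def)
    then show ?thesis using Suc.prems unfolding psd_qf a_def by metis
  qed
  \<comment> \<open>A Cholesky step. For \<open>a = 0\<close> division by zero makes \<open>z\<close> zero, as it should be.\<close>
  define z where "z = (\<lambda>i. F i D / of_real (sqrt a))"
  define G where "G = (\<lambda>i j. F i j - z i * cnj (z j))"
  have col: "z i * cnj (z D) = F i D" if "i < Suc D" for i
  proof (cases "a = 0")
    case True
    have "F i D = 0"
      using psd_zero_diag[OF Suc.prems, of i] herm[of D i] that Faa True by (cases "i = D") auto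
    then show ?thesis by (simp add: z_def)
  next
    case False
    have "z i * cnj (z D) = F i D * of_real a / (of_real (sqrt a) * of_real (sqrt a))"
      by (simp add: z_def Faa)
    also have "complex_of_real (sqrt a) * of_real (sqrt a) = of_real a"
      using a0 by (simp flip: of_real_mult)
    finally show ?thesis using False by simp
  qed
  have "psd D G"
    unfolding psd_qf
  proof
    fix v :: "nat \<Rightarrow> complex"
    define w where "w = (\<Sum>j<D. F D j * v j)"
    \<comment> \<open>The last coordinate minimises the form of F over extensions of v; the minimum
      is the form of the Schur complement G. For a = 0 it is 0 by division by zero, and w = 0 as
      well.\<close>
    define u where "u = v(D := - w / of_real a)"
    have zv: "(\<Sum>j<D. cnj (z j) * v j) = w / of_real (sqrt a)"
    proof -
      have "cnj (z j) = F D j / of_real (sqrt a)" if "j < D" for j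
        using herm[of j D] that by (simp add: z_def)
      then show ?thesis by (simp add: w_def sum_divide_distrib)
    qed
    have zv': "(\<Sum>i<D. cnj (v i) * z i) = cnj w / of_real (sqrt a)"
    proof -
      have "(\<Sum>i<D. cnj (v i) * z i) = cnj (\<Sum>j<D. cnj (z j) * v j)" by (simp add: mult.commute)
      then show ?thesis unfolding zv by simp
    qed
    have "qf D G v = qf D F v - (\<Sum>i<D. cnj (v i) * z i) * (\<Sum>j<D. cnj (z j) * v j)"
      by (simp only: qf_def G_def sum_product) (simp add: algebra_simps sum_subtractf)
    also have "\<dots> = qf D F v - cnj w * w / of_real a"
      unfolding zv zv' using a0 by (simp flip: of_real_mult)
    also have "\<dots> = qf (Suc D) F u"
    proof -
      have "qf D F u = qf D F v" "(\<Sum>j<D. F D j * u j) = w"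
        by (auto simp: qf_def u_def w_def)
      moreover have "w = 0" if "a = 0"
        using psd_zero_diag[OF Suc.prems] that Faa by (simp add: w_def)
      ultimately show ?thesis
        by (cases "a = 0") (simp_all add: qf_Suc[OF Suc.prems] u_def Faa)
    qed
    finally show "Im (qf D G v) = 0 \<and> 0 \<le> Re (qf D G v)"
      using Suc.prems unfolding psd_qf by metis
  qed
  from Suc.IH[OF this] obtain xs where xs: "\<And>i j. i < D \<Longrightarrow> j < D \<Longrightarrow> G i j = (\<Sum>x\<leftarrow>xs. x i * cnj (x j))"
    by blast
  define ys where "ys = z # map (\<lambda>x i. if i < D then x i else 0) xs"
  have "F i j = (\<Sum>x\<leftarrow>ys. x i * cnj (x j))" if ij: "i < Suc D" "j < Suc D" for i j
  proof -
    have *: "(\<Sum>x\<leftarrow>ys. x i * cnj (x j)) = z i * cnj (z j) +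
        (\<Sum>x\<leftarrow>xs. (if i < D then x i else 0) * cnj (if j < D then x j else 0))"
      by (simp add: ys_def comp_def)
    consider "i < D" "j < D" | "j = D" | "i = D" "j < D" using ij by linarith
    then show ?thesis
    proof cases
      case 1
      then show ?thesis using xs[of i j] by (simp add: * G_def diff_eq_eq add.commute)
    next
      case 2
      then show ?thesis unfolding * using col[OF ij(1)] by simp
    next
      case 3
      have "z D * cnj (z j) = cnj (z j * cnj (z D))" by simp
      also have "\<dots> = F D j" using col[OF ij(2)] herm[of j D] 3 by simp
      finally show ?thesis unfolding * using 3 by simp
    qed
  qed
  then show ?case by blast
qed

section \<open>The two channel outputs against a rank-one effect\<close>

lemma sum_blocks:
  fixes f :: "nat \<Rightarrow> 'a :: comm_monoid_add"
  shows "(\<Sum>i<d * d'. f i) = (\<Sum>p<d. \<Sum>b<d'. f (p * d' + b))"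
proof -
  have "(\<Sum>i<d * d'. f i) = (\<Sum>p<d. sum f {p * d'..<p * d' + d'})"
    by (rule sum.nat_group[symmetric])
  also have "\<dots> = (\<Sum>p<d. \<Sum>b<d'. f (p * d' + b))"
  proof (rule sum.cong[OF refl])
    fix p
    show "sum f {p * d'..<p * d' + d'} = (\<Sum>b<d'. f (p * d' + b))"
      using sum.shift_bounds_nat_ivl[of f 0 "p * d'" d'] by (simp add: atLeast0LessThan add.commute)
  qed
  finally show ?thesis .
qed

text \<open>The coefficient of \<open>M p c\<close> in the amplitude of (M tensor id) \<phi> against
  x, with the auxiliary register contracted.\<close>

definition coef :: "nat \<Rightarrow> (nat \<Rightarrow> complex) \<Rightarrow> (nat \<Rightarrow> complex) \<Rightarrow> nat \<Rightarrow> nat \<Rightarrow> complex" where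
  "coef d' x \<phi> p c = (\<Sum>b<d'. cnj (x (p * d' + b)) * \<phi> (c * d' + b))"

abbreviation re_coef :: "nat \<Rightarrow> (nat \<Rightarrow> complex) \<Rightarrow> (nat \<Rightarrow> complex) \<Rightarrow> rmat" where
  "re_coef d' x \<phi> \<equiv> \<lambda>p c. Re (coef d' x \<phi> p c)"

abbreviation im_coef :: "nat \<Rightarrow> (nat \<Rightarrow> complex) \<Rightarrow> (nat \<Rightarrow> complex) \<Rightarrow> rmat" where
  "im_coef d' x \<phi> \<equiv> \<lambda>p c. Im (coef d' x \<phi> p c)"

lemma orth_out_rank_one:
  "(\<Sum>i<d * d'. \<Sum>j<d * d'. x i * cnj (x j) * orth_out d d' M \<phi> j i) =
    of_real ((lin d (re_coef d' x \<phi>) M)\<^sup>2 + (lin d (im_coef d' x \<phi>) M)\<^sup>2)"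
proof -
  define \<psi> where "\<psi> = (\<lambda>i. \<Sum>a<d. complex_of_real (M (i div d') a) * \<phi> (a * d' + i mod d'))"
  define w where "w = (\<Sum>j<d * d'. cnj (x j) * \<psi> j)"
  have "w = (\<Sum>p<d. \<Sum>b<d'. cnj (x (p * d' + b)) * (\<Sum>a<d. of_real (M p a) * \<phi> (a * d' + b)))"
    unfolding w_def sum_blocks by (intro sum.cong refl) (simp add: \<psi>_def)
  also have "\<dots> = (\<Sum>p<d. \<Sum>a<d. of_real (M p a) * coef d' x \<phi> p a)"
  proof (rule sum.cong[OF refl])
    fix p
    show "(\<Sum>b<d'. cnj (x (p * d' + b)) * (\<Sum>a<d. of_real (M p a) * \<phi> (a * d' + b))) =
        (\<Sum>a<d. of_real (M p a) * coef d' x \<phi> p a)"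
      unfolding coef_def sum_distrib_left by (subst sum.swap) (simp add: mult_ac)
  qed
  finally have w: "w = (\<Sum>p<d. \<Sum>a<d. of_real (M p a) * coef d' x \<phi> p a)" .
  have "(\<Sum>i<d * d'. \<Sum>j<d * d'. x i * cnj (x j) * orth_out d d' M \<phi> j i) =
      (\<Sum>i<d * d'. \<Sum>j<d * d'. (x i * cnj (\<psi> i)) * (cnj (x j) * \<psi> j))"
    by (simp add: orth_out_def \<psi>_def mult_ac)
  also have "\<dots> = cnj w * w"
    by (simp add: w_def sum_product)
  also have "\<dots> = of_real ((Re w)\<^sup>2 + (Im w)\<^sup>2)"
    by (simp add: complex_mult_cnj mult.commute)
  also have "Re w = lin d (re_coef d' x \<phi>) M" by (simp add: w lin_def mult.commute)
  also have "Im w = lin d (im_coef d' x \<phi>) M" by (simp add: w lin_def mult.commute)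
  finally show ?thesis .
qed

lemma dep_out_rank_one:
  "(\<Sum>i<d * d'. \<Sum>j<d * d'. x i * cnj (x j) * dep_out d d' \<phi> j i) =
    of_real (sqn d (re_coef d' x \<phi>) / real d + sqn d (im_coef d' x \<phi>) / real d)"
proof -
  have "(\<Sum>i<d * d'. \<Sum>j<d * d'. x i * cnj (x j) * dep_out d d' \<phi> j i) =
      (\<Sum>p<d. \<Sum>b<d'. \<Sum>q<d. \<Sum>b'<d'. if p = q then x (p * d' + b) * cnj (x (q * d' + b')) *
         ((1 / of_nat d) * (\<Sum>c<d. \<phi> (c * d' + b') * cnj (\<phi> (c * d' + b)))) else 0)"
    unfolding sum_blocks by (intro sum.cong refl) (auto simp: dep_out_def)
  also have "\<dots> = (\<Sum>p<d. \<Sum>b<d'. \<Sum>b'<d'. x (p * d' + b) * cnj (x (p * d' + b')) *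
         ((1 / of_nat d) * (\<Sum>c<d. \<phi> (c * d' + b') * cnj (\<phi> (c * d' + b)))))"
  proof (rule sum.cong[OF refl], rule sum.cong[OF refl])
    fix p b assume "p \<in> {..<d}"
    then show "(\<Sum>q<d. \<Sum>b'<d'. if p = q then x (p * d' + b) * cnj (x (q * d' + b')) *
         ((1 / of_nat d) * (\<Sum>c<d. \<phi> (c * d' + b') * cnj (\<phi> (c * d' + b)))) else 0) =
      (\<Sum>b'<d'. x (p * d' + b) * cnj (x (p * d' + b')) *
         ((1 / of_nat d) * (\<Sum>c<d. \<phi> (c * d' + b') * cnj (\<phi> (c * d' + b)))))"
      by (subst sum.swap) simp
  qed
  also have "\<dots> = (1 / of_nat d) * (\<Sum>p<d. \<Sum>c<d. cnj (coef d' x \<phi> p c) * coef d' x \<phi> p c)"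
  proof -
    have "(\<Sum>b<d'. \<Sum>b'<d'. x (p * d' + b) * cnj (x (p * d' + b')) *
         ((1 / of_nat d) * (\<Sum>c<d. \<phi> (c * d' + b') * cnj (\<phi> (c * d' + b))))) =
      (1 / of_nat d) * (\<Sum>c<d. cnj (coef d' x \<phi> p c) * coef d' x \<phi> p c)" for p
    proof -
      have "(\<Sum>c<d. cnj (coef d' x \<phi> p c) * coef d' x \<phi> p c) =
          (\<Sum>c<d. \<Sum>b<d'. \<Sum>b'<d'. x (p * d' + b) * cnj (x (p * d' + b')) * (\<phi> (c * d' + b') * cnj (\<phi> (c * d' + b))))"
        by (simp only: coef_def cnj_sum complex_cnj_mult complex_cnj_cnj sum_product) (simp add: mult_ac)
      also have "\<dots> = (\<Sum>b<d'. \<Sum>b'<d'. \<Sum>c<d. x (p * d' + b) * cnj (x (p * d' + b')) * (\<phi> (c * d' + b') * cnj (\<phi> (c * d' + b))))"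
        by (subst sum.swap, subst (2) sum.swap) (rule refl)
      finally show ?thesis by (simp add: sum_distrib_left mult_ac)
    qed
    then show ?thesis by (simp add: sum_distrib_left)
  qed
  also have "\<dots> = of_real (sqn d (re_coef d' x \<phi>) / real d + sqn d (im_coef d' x \<phi>) / real d)"
  proof -
    have "cnj (coef d' x \<phi> p c) * coef d' x \<phi> p c = of_real ((Re (coef d' x \<phi> p c))\<^sup>2 + (Im (coef d' x \<phi> p c))\<^sup>2)"
      for p c by (simp add: complex_mult_cnj mult.commute)
    then show ?thesis
      by (simp add: sqn_def sum.distrib add_divide_distrib)
  qed
  finally show ?thesis .
qed

text \<open>One list of forms serves both channels, which permits a comparison term by term. Each
  complex amplitude contributes two real forms, its real and imaginary parts.\<close>

lemma outcome_prob_forms: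
  assumes "psd (d * d') F"
  obtains Bs where "\<And>M. outcome_prob (d * d') F (orth_out d d' M \<phi>) = (\<Sum>B\<leftarrow>Bs. (lin d B M)\<^sup>2)"
    "outcome_prob (d * d') F (dep_out d d' \<phi>) = (\<Sum>B\<leftarrow>Bs. sqn d B / real d)"
proof -
  obtain xs where xs: "\<And>i j. i < d * d' \<Longrightarrow> j < d * d' \<Longrightarrow> F i j = (\<Sum>x\<leftarrow>xs. x i * cnj (x j))"
    using psd_sum_rank_one[OF assms] by blast
  have expand: "outcome_prob (d * d') F \<sigma> =
      (\<Sum>x\<leftarrow>xs. Re (\<Sum>i<d * d'. \<Sum>j<d * d'. x i * cnj (x j) * \<sigma> j i))" for \<sigma>
  proof -
    have "outcome_prob (d * d') F \<sigma> =
        Re (\<Sum>i<d * d'. \<Sum>j<d * d'. (\<Sum>x\<leftarrow>xs. x i * cnj (x j)) * \<sigma> j i)"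
      unfolding outcome_prob_def using xs by simp
    also have "\<dots> = (\<Sum>x\<leftarrow>xs. Re (\<Sum>i<d * d'. \<Sum>j<d * d'. x i * cnj (x j) * \<sigma> j i))"
      by (induction xs) (simp_all add: sum.distrib distrib_right)
    finally show ?thesis .
  qed
  define Bs where "Bs = concat (map (\<lambda>x. [re_coef d' x \<phi>, im_coef d' x \<phi>]) xs)"
  show thesis
  proof
    show "outcome_prob (d * d') F (orth_out d d' M \<phi>) = (\<Sum>B\<leftarrow>Bs. (lin d B M)\<^sup>2)" for M
      unfolding expand orth_out_rank_one Bs_def by (induction xs) simp_all
    show "outcome_prob (d * d') F (dep_out d d' \<phi>) = (\<Sum>B\<leftarrow>Bs. sqn d B / real d)"
      unfolding expand dep_out_rank_one Bs_def by (induction xs) simp_all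
  qed
qed

lemma sum_outcome_prob:
  assumes "povm D m F"
  shows "(\<Sum>s<m. outcome_prob D (F s) \<sigma>) = Re (\<Sum>i<D. \<sigma> i i)"
proof -
  have "(\<Sum>s<m. outcome_prob D (F s) \<sigma>) = Re (\<Sum>s<m. \<Sum>i<D. \<Sum>j<D. F s i j * \<sigma> j i)"
    by (simp add: outcome_prob_def)
  also have "(\<Sum>s<m. \<Sum>i<D. \<Sum>j<D. F s i j * \<sigma> j i) = (\<Sum>i<D. \<Sum>j<D. \<Sum>s<m. F s i j * \<sigma> j i)"
    by (subst sum.swap, subst (2) sum.swap) (rule refl)
  also have "\<dots> = (\<Sum>i<D. \<Sum>j<D. if i = j then \<sigma> j i else 0)"
    using assms by (intro sum.cong refl) (simp add: povm_def flip: sum_distrib_right)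
  finally show ?thesis by simp
qed

lemma pure_state_blocks:
  "pure_state (d * d') \<phi> \<Longrightarrow> (\<Sum>a<d. \<Sum>b<d'. \<phi> (a * d' + b) * cnj (\<phi> (a * d' + b))) = 1"
  unfolding pure_state_def sum_blocks
  by (simp add: complex_norm_square[symmetric] flip: of_real_sum of_real_power)

lemma trace_orth_out:
  assumes "orthogonal_real d M" "pure_state (d * d') \<phi>"
  shows "(\<Sum>i<d * d'. orth_out d d' M \<phi> i i) = 1"
proof -
  have "(\<Sum>i<d * d'. orth_out d d' M \<phi> i i) =
     (\<Sum>p<d. \<Sum>b<d'. \<Sum>a<d. \<Sum>c<d. of_real (M p a * M p c) * (\<phi> (a * d' + b) * cnj (\<phi> (c * d' + b))))"
    unfolding sum_blocks by (intro sum.cong refl) (simp add: orth_out_def sum_product mult_ac)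
  also have "\<dots> = (\<Sum>b<d'. \<Sum>a<d. \<Sum>c<d. \<Sum>p<d. of_real (M p a * M p c) * (\<phi> (a * d' + b) * cnj (\<phi> (c * d' + b))))"
    by (subst sum.swap, subst (2) sum.swap, subst (3) sum.swap) (rule refl)
  also have "\<dots> = (\<Sum>b<d'. \<Sum>a<d. \<Sum>c<d. if a = c then \<phi> (a * d' + b) * cnj (\<phi> (c * d' + b)) else 0)"
  proof (intro sum.cong refl)
    fix a c b assume ac: "a \<in> {..<d}" "c \<in> {..<d}"
    define X where "X = \<phi> (a * d' + b) * cnj (\<phi> (c * d' + b))"
    have "(\<Sum>p<d. of_real (M p a * M p c) * X) = of_real (\<Sum>p<d. M p a * M p c) * X"
      by (simp add: sum_distrib_right)
    also have "(\<Sum>p<d. M p a * M p c) = (if a = c then 1 else 0)"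
      using assms(1) ac by (simp add: orthogonal_real_def)
    finally show "(\<Sum>p<d. of_real (M p a * M p c) * (\<phi> (a * d' + b) * cnj (\<phi> (c * d' + b)))) =
        (if a = c then \<phi> (a * d' + b) * cnj (\<phi> (c * d' + b)) else 0)"
      by (simp add: X_def)
  qed
  also have "\<dots> = (\<Sum>a<d. \<Sum>b<d'. \<phi> (a * d' + b) * cnj (\<phi> (a * d' + b)))"
    by (subst sum.swap) simp
  finally show ?thesis using pure_state_blocks[OF assms(2)] by simp
qed

lemma trace_dep_out:
  assumes "0 < d" "pure_state (d * d') \<phi>"
  shows "(\<Sum>i<d * d'. dep_out d d' \<phi> i i) = 1"
proof -
  have "(\<Sum>i<d * d'. dep_out d d' \<phi> i i) =
     (\<Sum>p<d. (1 / of_nat d) * (\<Sum>b<d'. \<Sum>c<d. \<phi> (c * d' + b) * cnj (\<phi> (c * d' + b))))"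
    unfolding sum_blocks by (simp add: dep_out_def sum_distrib_left)
  also have "\<dots> = (\<Sum>c<d. \<Sum>b<d'. \<phi> (c * d' + b) * cnj (\<phi> (c * d' + b)))"
    using assms(1) by (subst sum.swap) simp
  finally show ?thesis using pure_state_blocks[OF assms(2)] by simp
qed

section \<open>Transcripts\<close>

text \<open>Transcript probabilities sum to 1. This allows passing to the negated output, where a
  one-sided bound is useful.\<close>

lemma accept_prob_complement:
  assumes "\<And>\<phi> m F. pure_state D \<phi> \<Longrightarrow> povm D m F \<Longrightarrow> (\<Sum>s<m. outcome_prob D (F s) (chan \<phi>)) = 1"
    and valid: "valid_strategy D strat"
  shows "accept_prob D chan strat out T h + accept_prob D chan strat (\<lambda>h. \<not> out h) T h = 1"
proof (induction T arbitrary: h)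
  case (Suc T)
  obtain \<phi> m F where strat: "strat h = (\<phi>, m, F)" by (cases "strat h") auto
  have "pure_state D \<phi>" "povm D m F"
    using valid[unfolded valid_strategy_def, rule_format, of h] by (auto simp: strat)
  then show ?case
    using assms(1) Suc by (simp add: strat flip: sum.distrib distrib_left)
qed auto

lemma accept_prob_orth_complement:
  "orthogonal_real d M \<Longrightarrow> valid_strategy (d * d') strat \<Longrightarrow>
    accept_prob (d * d') (orth_out d d' M) strat out T h
    + accept_prob (d * d') (orth_out d d' M) strat (\<lambda>h. \<not> out h) T h = 1"
  by (rule accept_prob_complement) (simp_all add: sum_outcome_prob trace_orth_out)

lemma accept_prob_dep_complement:
  "0 < d \<Longrightarrow> valid_strategy (d * d') strat \<Longrightarrow>
    accept_prob (d * d') (dep_out d d') strat out T h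
    + accept_prob (d * d') (dep_out d d') strat (\<lambda>h. \<not> out h) T h = 1"
  by (rule accept_prob_complement) (simp_all add: sum_outcome_prob trace_dep_out)

lemma accept_prob_dep_nonneg:
  assumes "valid_strategy (d * d') strat"
  shows "0 \<le> accept_prob (d * d') (dep_out d d') strat out T h"
proof (induction T arbitrary: h)
  case (Suc T)
  obtain \<phi> m F where strat: "strat h = (\<phi>, m, F)" by (cases "strat h") auto
  have "0 \<le> outcome_prob (d * d') (F s) (dep_out d d' \<phi>)" if "s < m" for s
  proof -
    have "psd (d * d') (F s)"
      using assms[unfolded valid_strategy_def, rule_format, of h] that by (auto simp: strat povm_def)
    then obtain Bs where "outcome_prob (d * d') (F s) (dep_out d d' \<phi>) = (\<Sum>B\<leftarrow>Bs. sqn d B / real d)"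
      by (rule outcome_prob_forms)
    then show ?thesis by (auto intro!: sum_list_nonneg simp: sqn_nonneg)
  qed
  then show ?case using Suc by (auto simp: strat intro!: sum_nonneg)
qed auto

context orth_haar
begin

lemma pol_accept_prob:
  assumes "valid_strategy (d * d') strat"
  shows "pol d (\<lambda>M. accept_prob (d * d') (orth_out d d' M) strat out T h)"
proof (induction T arbitrary: h)
  case (Suc T)
  obtain \<phi> m F where strat: "strat h = (\<phi>, m, F)" by (cases "strat h") auto
  have "pol d (\<lambda>M. outcome_prob (d * d') (F s) (orth_out d d' M \<phi>))" if "s < m" for s
  proof -
    have "psd (d * d') (F s)"
      using assms[unfolded valid_strategy_def, rule_format, of h] that by (auto simp: strat povm_def)
    then obtain Bs where "\<And>M. outcome_prob (d * d') (F s) (orth_out d d' M \<phi>) = (\<Sum>B\<leftarrow>Bs. (lin d B M)\<^sup>2)"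
      by (rule outcome_prob_forms) blast
    then show ?thesis by simp
  qed
  then show ?case using Suc by (auto simp: strat intro!: pol_sum)
qed auto

text \<open>As collects the forms along one path of the tree of transcripts, which is why adaptivity
  is harmless: at each leaf the N forms are fixed by the path and do not depend on O, and
  \<open>prod\<close> is applied there.\<close>

lemma accept_prob_ge:
  assumes prod: "\<And>As. length As = N \<Longrightarrow>
      c * (\<Prod>A\<leftarrow>As. sqn d A / real d) \<le> E (\<lambda>M. \<Prod>A\<leftarrow>As. (lin d A M)\<^sup>2)"
    and valid: "valid_strategy (d * d') strat"
  shows "length As + T = N \<Longrightarrow>
    c * (\<Prod>A\<leftarrow>As. sqn d A / real d) * accept_prob (d * d') (dep_out d d') strat out T h
    \<le> E (\<lambda>M. (\<Prod>A\<leftarrow>As. (lin d A M)\<^sup>2) * accept_prob (d * d') (orth_out d d' M) strat out T h)"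
proof (induction T arbitrary: As h)
  case 0
  then show ?case using prod[of As] by (simp cong: if_cong)
next
  case (Suc T)
  obtain \<phi> m F where strat: "strat h = (\<phi>, m, F)" by (cases "strat h") auto
  let ?dep = "\<lambda>h. accept_prob (d * d') (dep_out d d') strat out T h"
  let ?orth = "\<lambda>M h. accept_prob (d * d') (orth_out d d' M) strat out T h"
  let ?P = "\<Prod>A\<leftarrow>As. sqn d A / real d" and ?Q = "\<lambda>M. \<Prod>A\<leftarrow>As. (lin d A M)\<^sup>2"
  note pol = pol_accept_prob[OF valid]
  have "c * ?P * (outcome_prob (d * d') (F s) (dep_out d d' \<phi>) * ?dep (h @ [s]))
      \<le> E (\<lambda>M. ?Q M * (outcome_prob (d * d') (F s) (orth_out d d' M \<phi>) * ?orth M (h @ [s])))"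
    (is "?lhs s \<le> ?rhs s") and
    "pol d (\<lambda>M. ?Q M * (outcome_prob (d * d') (F s) (orth_out d d' M \<phi>) * ?orth M (h @ [s])))" (is "?pol s")
    if s: "s < m" for s
  proof -
    have "psd (d * d') (F s)"
      using valid[unfolded valid_strategy_def, rule_format, of h] s by (auto simp: strat povm_def)
    then obtain Bs where Bs:
      "\<And>M. outcome_prob (d * d') (F s) (orth_out d d' M \<phi>) = (\<Sum>B\<leftarrow>Bs. (lin d B M)\<^sup>2)"
      "outcome_prob (d * d') (F s) (dep_out d d' \<phi>) = (\<Sum>B\<leftarrow>Bs. sqn d B / real d)"
      by (rule outcome_prob_forms) blast
    show "?pol s" unfolding Bs(1) using pol by simp
    have "?lhs s = (\<Sum>B\<leftarrow>Bs. c * (\<Prod>A\<leftarrow>B # As. sqn d A / real d) * ?dep (h @ [s]))"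
      unfolding Bs(2) by (induction Bs) (simp_all add: algebra_simps)
    also have "\<dots> \<le> (\<Sum>B\<leftarrow>Bs. E (\<lambda>M. (\<Prod>A\<leftarrow>B # As. (lin d A M)\<^sup>2) * ?orth M (h @ [s])))"
      using Suc.prems by (intro sum_list_mono Suc.IH) simp
    also have "\<dots> = ?rhs s"
      unfolding Bs(1)
    proof (induction Bs)
      case (Cons B Bs)
      have "E (\<lambda>M. ?Q M * ((\<Sum>B\<leftarrow>B # Bs. (lin d B M)\<^sup>2) * ?orth M (h @ [s]))) =
          E (\<lambda>M. (\<Prod>A\<leftarrow>B # As. (lin d A M)\<^sup>2) * ?orth M (h @ [s]) + ?Q M * ((\<Sum>B\<leftarrow>Bs. (lin d B M)\<^sup>2) * ?orth M (h @ [s])))"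
        by (simp add: algebra_simps)
      also have "\<dots> = E (\<lambda>M. (\<Prod>A\<leftarrow>B # As. (lin d A M)\<^sup>2) * ?orth M (h @ [s])) + E (\<lambda>M. ?Q M * ((\<Sum>B\<leftarrow>Bs. (lin d B M)\<^sup>2) * ?orth M (h @ [s])))"
        using pol by (intro Bochner_Integration.integral_add integrable_pol) auto
      finally show ?case using Cons.IH by simp
    qed simp
    finally show "?lhs s \<le> ?rhs s" .
  qed
  note step = this
  have "c * ?P * accept_prob (d * d') (dep_out d d') strat out (Suc T) h = (\<Sum>s<m. ?lhs s)"
    by (simp add: strat sum_distrib_left)
  also have "\<dots> \<le> (\<Sum>s<m. ?rhs s)" using step(1) by (intro sum_mono) auto
  also have "\<dots> = E (\<lambda>M. \<Sum>s<m. ?Q M * (outcome_prob (d * d') (F s) (orth_out d d' M \<phi>) * ?orth M (h @ [s])))"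
    using step(2) by (intro Bochner_Integration.integral_sum[symmetric] integrable_pol) auto
  finally show ?case by (simp add: strat sum_distrib_left)
qed

lemma success_prob_less:
  assumes d: "d \<ge> 2" and valid: "valid_strategy (d * d') strat"
    and T: "12 * (real T)^3 \<le> real d - 1" and loss: "loss d T \<le> 1" "real T * loss d T \<le> 1/4"
  shows "success_prob d d' \<mu> strat out T < 2/3"
proof -
  define a where "a = accept_prob (d * d') (dep_out d d') strat out T []"
  define b where "b = E (\<lambda>M. accept_prob (d * d') (orth_out d d' M) strat out T [])"
  define a' where "a' = accept_prob (d * d') (dep_out d d') strat (\<lambda>h. \<not> out h) T []"
  define b' where "b' = E (\<lambda>M. accept_prob (d * d') (orth_out d d' M) strat (\<lambda>h. \<not> out h) T [])"
  note pol = pol_accept_prob[OF valid]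
  have aa: "a + a' = 1" using accept_prob_dep_complement[OF _ valid] d by (simp add: a_def a'_def)
  have "b + b' = E (\<lambda>M. accept_prob (d * d') (orth_out d d' M) strat out T []
      + accept_prob (d * d') (orth_out d d' M) strat (\<lambda>h. \<not> out h) T [])"
    unfolding b_def b'_def using pol by simp
  also have "\<dots> = E (\<lambda>_. 1)"
    using pol accept_prob_orth_complement[OF _ valid] by (intro E_cong) auto
  finally have bb: "b + b' = 1" by (simp add: prob_space)
  have a: "0 \<le> a" "0 \<le> a'"
    using accept_prob_dep_nonneg[OF valid] by (simp_all add: a_def a'_def)
  \<comment> \<open>Used for the negated output: b - a = a' - b' <= a' / 4 <= 1/4, so success is at
    most 5/8.\<close>
  have "(1 - real T * loss d T) * a' \<le> b'"
    using accept_prob_ge[OF E_prod_lin_sq[OF d T loss(1)] valid, of T "[]" T] by (simp add: a'_def b'_def)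
  moreover have "3/4 * a' \<le> (1 - real T * loss d T) * a'"
    using loss(2) a by (intro mult_right_mono) auto
  ultimately have "b - a \<le> 1/4" using aa bb a by linarith
  then show ?thesis unfolding success_prob_def a_def[symmetric] b_def[symmetric] by argo
qed

text \<open>Without queries the output is constant and success is 1/2. The case stands apart because
  \<open>few_rounds_small_loss\<close> derives d >= 2 from T >= 1.\<close>

lemma success_prob_0:
  "success_prob d d' \<mu> strat out 0 < 2/3"
  by (simp add: success_prob_def prob_space)

end

text \<open>(1/16)^(7/2) = 1/16384 and d <= 2 (d - 1), so T^(7/2) / (d - 1) is below 1/900, a value
  chosen for its square root 1/30: then T times the loss is at most 5/30 + 6/900 < 1/4.\<close>

lemma few_rounds_small_loss:
  assumes T: "T \<ge> 1" "real T < 1/16 * real d powr (2/7)"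
  shows "d \<ge> 2" "12 * (real T)^3 \<le> real d - 1" "loss d T \<le> 1" "real T * loss d T \<le> 1/4"
proof -
  have T1: "real T \<ge> 1" using T by simp
  show d: "d \<ge> 2"
  proof (rule ccontr)
    assume "\<not> d \<ge> 2"
    then have "d = 0 \<or> d = 1" by linarith
    then show False using T T1 by auto
  qed
  define m where "m = real d - 1"
  define S where "S = (real T)^3 * sqrt (real T)"
  have m: "m \<ge> 1" using d by (simp add: m_def)
  have half: "x powr (7/2) = x^3 * sqrt x" if "x > 0" for x :: real
  proof -
    have "x powr (7/2) = x powr (3 + 1/2)" by simp
    also have "\<dots> = x powr 3 * x powr (1/2)" by (rule powr_add)
    finally show ?thesis using that by (simp add: powr_half_sqrt)
  qed
  have "S = real T powr (7/2)" using T1 half[of "real T"] by (simp add: S_def)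
  also have "\<dots> \<le> (1/16 * real d powr (2/7)) powr (7/2)"
    using T T1 by (intro powr_mono2) auto
  also have "\<dots> = (1/16) powr (7/2) * (real d powr (2/7)) powr (7/2)"
    by (rule powr_mult)
  also have "(1/16 :: real) powr (7/2) = 1/16384"
    by (simp add: half real_sqrt_divide power_divide)
  also have "(real d powr (2/7)) powr (7/2) = real d"
    using d by (simp add: powr_powr)
  finally have "S \<le> real d / 16384" by simp
  then have S: "S / m \<le> 1 / 900"
    using m by (simp add: m_def field_simps)
  have T3S: "(real T)^3 \<le> S"
    using T1 mult_left_mono[of 1 "sqrt (real T)" "(real T)^3"] by (simp add: S_def)
  have T3: "(real T)^3 / m \<le> 1 / 900"
    using divide_right_mono[OF T3S, of m] S m by linarith
  show "12 * (real T)^3 \<le> real d - 1"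
    using T3 m T1 unfolding m_def[symmetric] by (simp add: field_simps)
  have "real T * sqrt (real T / m) = sqrt ((real T)^3 / m)"
  proof -
    have "(real T)^3 / m = (real T)\<^sup>2 * (real T / m)" by (simp add: power2_eq_square power3_eq_cube)
    then show ?thesis by (simp only: real_sqrt_mult real_sqrt_abs abs_of_nat)
  qed
  also have "\<dots> \<le> sqrt (1 / 900)" using T3 by (rule real_sqrt_le_mono)
  also have "sqrt (1 / 900) = (1 / 30 :: real)"
  proof -
    have "(1 / 900 :: real) = (1 / 30)\<^sup>2" by (simp add: power2_eq_square)
    then show ?thesis by (simp only: real_sqrt_abs abs_divide abs_one abs_numeral)
  qed
  finally have 1: "real T * sqrt (real T / m) \<le> 1 / 30" .
  have "real T * loss d T = 5 * (real T * sqrt (real T / m)) + 6 * (S / m)"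
    by (simp add: loss_def S_def m_def distrib_left power2_eq_square power3_eq_cube)
  also have "\<dots> \<le> 1/4" using 1 S by linarith
  finally show TL: "real T * loss d T \<le> 1/4" .
  have "0 \<le> loss d T" using m unfolding loss_def m_def[symmetric] by simp
  then have "loss d T \<le> real T * loss d T" using T1 mult_right_mono[of 1 "real T" "loss d T"] by simp
  then show "loss d T \<le> 1" using TL by linarith
qed

theorem mainTheorem14:
  shows "\<exists>c > (0::real). \<forall>(n::nat) (n'::nat) (T::nat) (strat::strategy) (out::nat list \<Rightarrow> bool)
            (\<mu>::(nat \<Rightarrow> nat \<Rightarrow> real) measure).
           haar_orthogonal (2 ^ n) \<mu> \<longrightarrow>
           valid_strategy (2 ^ n * 2 ^ n') strat \<longrightarrow>
           success_prob (2 ^ n) (2 ^ n') \<mu> strat out T \<ge> 2/3 \<longrightarrow>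
           real T \<ge> c * (2 ^ n) powr (2/7)"
proof (intro exI[of _ "1/16"] conjI allI impI)
  fix n n' T :: nat and strat :: strategy and out \<mu>
  assume haar: "haar_orthogonal (2 ^ n) \<mu>" and valid: "valid_strategy (2 ^ n * 2 ^ n') strat"
    and success: "success_prob (2 ^ n) (2 ^ n') \<mu> strat out T \<ge> 2/3"
  interpret orth_haar "2 ^ n" \<mu> by unfold_locales (rule haar)
  show "1/16 * (2 ^ n) powr (2/7) \<le> real T"
  proof (rule ccontr)
    assume neg: "\<not> 1/16 * (2 ^ n) powr (2/7) \<le> real T"
    have "T \<noteq> 0"
    proof
      assume "T = 0"
      then show False using success success_prob_0[of "2 ^ n'" strat out] by simp
    qed
    then have "T \<ge> 1" "real T < 1/16 * real (2 ^ n) powr (2/7)" using neg by auto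
    then have "success_prob (2 ^ n) (2 ^ n') \<mu> strat out T < 2/3"
      by (intro success_prob_less valid few_rounds_small_loss)
    then show False using success by linarith
  qed
qed simp

end
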